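(* Let $X=\partial_x$ and $Y=x\,\partial_y$ be the Grushin vector fields on $\mathbb R^2$, with $Z=[X,Y]=\partial_y$, and let $H_i\in C^1(\mathbb R^m)$, $1\le i\le m$. Suppose that $u=(u_i)_{i=1}^m\in C^2(\mathbb R^2,\mathbb R^m)$ is a stable solution of the symmetric system $$\partial_{xx}u_i+x^2\partial_{yy}u_i=H_i(u_1,\dots,u_m)\quad\text{in }\mathbb R^2,\qquad 1\le i\le m,$$ satisfying, for each $i$, $$ZYu_i\,Xu_i-ZXu_i\,Yu_i\le0 .$$ In addition, assume that there is a constant $C$ such that $$\int_{B_R}x^2|\nabla_{\mathbb G}u_i|^2\,dx\,dy\le CR^4\quad\text{for all }R>1\text{ and }1\le i\le m,$$ where $B_R=\{(x,y)\in\mathbb R^2:\ x^4+y^2<R^4\}$. Then, for every $i$, $\mathcal A_i\equiv0$ (the intrinsic curvature of the level sets of $u_i$ vanishes identically) and $\mathcal B_i\equiv0$ on $\{|\nabla_{\mathbb G}u_i|\ne0\}$.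
   Context: $\nabla_{\mathbb G}v:=(Xv)X+(Yv)Y$, $|\nabla_{\mathbb G}v|=\sqrt{(Xv)^2+(Yv)^2}$. For $\zeta=\zeta_1X+\zeta_2Y$, $\theta=\theta_1X+\theta_2Y$ (identified with coefficient pairs): $\operatorname{div}_{XY}(\zeta)=X\zeta_1+Y\zeta_2$, $\langle\zeta,\theta\rangle_{XY}=\zeta_1\theta_1+\zeta_2\theta_2$. On $\{|\nabla_{\mathbb G}u_i|\ne0\}$ set $$\eta_i=|\nabla_{\mathbb G}u_i|^{-1}[(Xu_i)X+(Yu_i)Y],\quad \tau_i=|\nabla_{\mathbb G}u_i|^{-1}[(Yu_i)X-(Xu_i)Y],$$ $$\mathcal A_i=\operatorname{div}_{XY}(\eta_i),\quad \mathcal B_i=|\nabla_{\mathbb G}u_i|^{-1}\left[-Zu_i+\langle H_{ess}u_i\,\tau_i,\eta_i\rangle_{XY}\right],\quad H_{ess}u_i=\begin{bmatrix} XXu_i & YXu_i \\ XYu_i & YYu_i \end{bmatrix}.$$ The system is called symmetric if the matrix $(\partial_iH_j(u))_{i,j=1}^m$ is symmetric. A solution $u$ is called stable if $-\sum_{i,j=1}^m\int_{\mathbb R^2}\partial_iH_j(u)\zeta_i\zeta_j\le\sum_{i=1}^m\int_{\mathbb R^2}|\nabla_{\mathbb G}\zeta_i|^2$ for all $\zeta_i\in C_c^1(\mathbb R^2)$, $1\le i\le m$. *)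

theory Defs
  imports "HOL-Analysis.Analysis"
begin

definition C1 :: "('a::real_normed_vector \<Rightarrow> 'b::real_normed_vector) \<Rightarrow> bool" where
  "C1 f \<longleftrightarrow> (\<exists>f' :: 'a \<Rightarrow> 'a \<Rightarrow>\<^sub>L 'b.
     (\<forall>x. (f has_derivative blinfun_apply (f' x)) (at x)) \<and> continuous_on UNIV f')"

definition C2 :: "('a::real_normed_vector \<Rightarrow> 'b::real_normed_vector) \<Rightarrow> bool" where
  "C2 f \<longleftrightarrow> (\<exists>f' :: 'a \<Rightarrow> 'a \<Rightarrow>\<^sub>L 'b.
     (\<forall>x. (f has_derivative blinfun_apply (f' x)) (at x)) \<and> C1 f')"

definition C1_compact_support :: "(real \<times> real \<Rightarrow> real) \<Rightarrow> bool" where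
  "C1_compact_support \<zeta> \<longleftrightarrow> C1 \<zeta> \<and> compact (closure {p. \<zeta> p \<noteq> 0})"

definition partial :: "'n::finite \<Rightarrow> (real^'n \<Rightarrow> real) \<Rightarrow> real^'n \<Rightarrow> real" where
  "partial i f v = deriv (\<lambda>t. f (v + t *\<^sub>R axis i 1)) 0"

definition dx :: "(real \<times> real \<Rightarrow> real) \<Rightarrow> real \<times> real \<Rightarrow> real" where
  "dx f p = deriv (\<lambda>t. f (t, snd p)) (fst p)"

definition dy :: "(real \<times> real \<Rightarrow> real) \<Rightarrow> real \<times> real \<Rightarrow> real" where
  "dy f p = deriv (\<lambda>t. f (fst p, t)) (snd p)"


subsection \<open>Grushin vector fields\<close>

definition X :: "(real \<times> real \<Rightarrow> real) \<Rightarrow> real \<times> real \<Rightarrow> real" where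
  "X f = dx f"

definition Y :: "(real \<times> real \<Rightarrow> real) \<Rightarrow> real \<times> real \<Rightarrow> real" where
  "Y f p = fst p * dy f p"

text \<open>The commutator of \<open>X\<close> and \<open>Y\<close> is \<open>\<partial>\<^sub>y\<close>; it is defined as this first-order operator because
  it is also applied to functions that are merely once differentiable.\<close>

definition Z :: "(real \<times> real \<Rightarrow> real) \<Rightarrow> real \<times> real \<Rightarrow> real" where
  "Z f = dy f"

text \<open>A horizontal vector field \<open>\<zeta>\<^sub>1 X + \<zeta>\<^sub>2 Y\<close> is encoded by its coefficient vector in
  \<open>real^2\<close>, so that \<open>\<langle>\<cdot>,\<cdot>\<rangle>\<close> is the inner product and \<open>norm\<close> is the length.\<close>

definition grad :: "(real \<times> real \<Rightarrow> real) \<Rightarrow> real \<times> real \<Rightarrow> real^2" where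
  "grad v p = vector [X v p, Y v p]"

definition div_XY :: "(real \<times> real \<Rightarrow> real^2) \<Rightarrow> real \<times> real \<Rightarrow> real" where
  "div_XY \<zeta> p = X (\<lambda>q. \<zeta> q $ 1) p + Y (\<lambda>q. \<zeta> q $ 2) p"

definition H_ess :: "(real \<times> real \<Rightarrow> real) \<Rightarrow> real \<times> real \<Rightarrow> real^2^2" where
  "H_ess v p = vector [vector [X (X v) p, Y (X v) p],
                       vector [X (Y v) p, Y (Y v) p]]"

text \<open>The following four are meaningful only where \<open>grad v p \<noteq> 0\<close> (an open set for
  continuously differentiable \<open>v\<close>).\<close>

definition eta :: "(real \<times> real \<Rightarrow> real) \<Rightarrow> real \<times> real \<Rightarrow> real^2" where
  "eta v p = (1 / norm (grad v p)) *\<^sub>R vector [X v p, Y v p]"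

definition tau :: "(real \<times> real \<Rightarrow> real) \<Rightarrow> real \<times> real \<Rightarrow> real^2" where
  "tau v p = (1 / norm (grad v p)) *\<^sub>R vector [Y v p, - X v p]"

definition curvA :: "(real \<times> real \<Rightarrow> real) \<Rightarrow> real \<times> real \<Rightarrow> real" where
  "curvA v = div_XY (eta v)"

definition curvB :: "(real \<times> real \<Rightarrow> real) \<Rightarrow> real \<times> real \<Rightarrow> real" where
  "curvB v p = (1 / norm (grad v p)) * (- Z v p + (H_ess v p *v tau v p) \<bullet> eta v p)"

definition grushin_ball :: "real \<Rightarrow> (real \<times> real) set" where
  "grushin_ball R = {(x, y). x ^ 4 + y ^ 2 < R ^ 4}"


subsection \<open>The system\<close>

abbreviation coord :: "('a \<Rightarrow> real^'m) \<Rightarrow> 'm \<Rightarrow> 'a \<Rightarrow> real" where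
  "coord f i \<equiv> (\<lambda>p. f p $ i)"

definition solution :: "(real^'m \<Rightarrow> real^'m) \<Rightarrow> (real \<times> real \<Rightarrow> real^'m::finite) \<Rightarrow> bool" where
  "solution H u \<longleftrightarrow> (\<forall>i x y.
     dx (dx (coord u i)) (x, y) + x ^ 2 * dy (dy (coord u i)) (x, y) = H (u (x, y)) $ i)"

definition symmetric_system :: "(real^'m \<Rightarrow> real^'m) \<Rightarrow> (real \<times> real \<Rightarrow> real^'m::finite) \<Rightarrow> bool" where
  "symmetric_system H u \<longleftrightarrow> (\<forall>p i j. partial i (coord H j) (u p) = partial j (coord H i) (u p))"

definition stable_solution :: "(real^'m \<Rightarrow> real^'m) \<Rightarrow> (real \<times> real \<Rightarrow> real^'m::finite) \<Rightarrow> bool" where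
  "stable_solution H u \<longleftrightarrow> solution H u \<and>
     (\<forall>\<zeta> :: 'm \<Rightarrow> real \<times> real \<Rightarrow> real. (\<forall>i. C1_compact_support (\<zeta> i)) \<longrightarrow>
        - (\<Sum>i\<in>UNIV. \<Sum>j\<in>UNIV. LINT p|lborel. partial i (coord H j) (u p) * \<zeta> i p * \<zeta> j p)
        \<le> (\<Sum>i\<in>UNIV. LINT p|lborel. (norm (grad (\<zeta> i) p))\<^sup>2))"

end

theory Submission
  imports Defs
begin

text \<open>Let \<open>Q\<close> be the quadratic form of the stability inequality. Differentiating the system gives
  \<open>Q(X u, \<psi>) = 2 \<Sum>\<integral> ZYu\<^sub>i \<psi>\<^sub>i\<close> and \<open>Q(Y u, \<psi>) = - 2 \<Sum>\<integral> ZXu\<^sub>i \<psi>\<^sub>i\<close>, because \<open>X\<close> and \<open>Y\<close> do not commute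
  with the Grushin operator. Hence, by the sign condition, \<open>Q(\<phi> X u) + Q(\<phi> Y u)\<close> is at most
  \<open>\<Sum>\<integral> |\<nabla>u\<^sub>i|\<^sup>2 |\<nabla>\<phi>|\<^sup>2\<close>, and the growth condition makes this arbitrarily small for logarithmic cutoff
  functions \<open>\<phi>\<close>. So \<open>X u\<close> and \<open>Y u\<close> are null vectors of the nonnegative form \<open>Q\<close>, which forces
  \<open>ZYu\<^sub>i = ZXu\<^sub>i = 0\<close>. Then \<open>\<partial>\<^sub>y u\<^sub>i\<close> is constant, the growth condition makes this constant zero, and
  \<open>u\<^sub>i\<close> is a function of \<open>x\<close> alone. Testing with both \<open>X u\<close> and \<open>Y u\<close> instead of \<open>|\<nabla>u\<^sub>i|\<close> avoids any
  assumption on the signs of the coupling coefficients \<open>\<partial>\<^sub>i H\<^sub>j\<close>.\<close>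

section \<open>Continuously differentiable functions on the plane\<close>

text \<open>Low regularity shapes the proof. As \<open>u\<close> is only C2, \<open>X u\<close> and
  \<open>Y u\<close> are only C1, so the differentiated system has a meaning only in weak form. It
  has to be tested with \<open>\<phi>^2 X u\<close> and \<open>\<phi>^2 Y u\<close>, which are no
  better than C1. Hence an integration by parts is required in which neither factor has second
  derivatives. The weight \<open>x^2\<close> in the growth condition is the degeneracy of the gauge:
  the squared horizontal gradient of \<open>x^4 + y^2\<close> is at most
  \<open>16 x^2 (x^4 + y^2)\<close>. The exponent 4 is borderline: a cutoff living on one scale has
  an energy that is bounded independently of the scale but need not be small, so many scales have to
  be averaged. The sign condition controls only the sum of the two energies; stability makes each of
  them nonnegative and thereby each of them small. Being a null vector gives
  \<open>Q(X u, \<psi>) = 0\<close> for every \<open>\<psi>\<close>, and comparison with the weak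
  equation leaves a source orthogonal to all test functions.\<close>

lemma has_derivative_imp_dx_dy:
  assumes "(f has_derivative D) (at p)"
  shows "((\<lambda>t. f (t, snd p)) has_field_derivative D (1, 0)) (at (fst p))" "dx f p = D (1, 0)"
    "((\<lambda>t. f (fst p, t)) has_field_derivative D (0, 1)) (at (snd p))" "dy f p = D (0, 1)"
proof -
  interpret D: bounded_linear D using assms by (rule has_derivative_bounded_linear)
  have "((\<lambda>t. f (t, snd p)) has_derivative (\<lambda>h. D (h, 0))) (at (fst p))"
    using has_derivative_compose[OF has_derivative_Pair[OF has_derivative_ident has_derivative_const],
        of f D "fst p" "snd p"] assms
    by simp
  moreover have "(\<lambda>h. D (h, 0)) = (*) (D (1, 0))"
  proof
    show "D (h, 0) = D (1, 0) * h" for h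
      using D.scaleR[of h "(1, 0)"] by simp
  qed
  ultimately show 1: "((\<lambda>t. f (t, snd p)) has_field_derivative D (1, 0)) (at (fst p))"
    by (simp add: has_field_derivative_def)
  show "dx f p = D (1, 0)"
    unfolding dx_def by (rule DERIV_imp_deriv[OF 1])
  have "((\<lambda>t. f (fst p, t)) has_derivative (\<lambda>h. D (0, h))) (at (snd p))"
    using has_derivative_compose[OF has_derivative_Pair[OF has_derivative_const has_derivative_ident],
        of f D "fst p" "snd p"] assms
    by simp
  moreover have "(\<lambda>h. D (0, h)) = (*) (D (0, 1))"
  proof
    show "D (0, h) = D (0, 1) * h" for h
      using D.scaleR[of h "(0, 1)"] by simp
  qed
  ultimately show 2: "((\<lambda>t. f (fst p, t)) has_field_derivative D (0, 1)) (at (snd p))"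
    by (simp add: has_field_derivative_def)
  show "dy f p = D (0, 1)"
    unfolding dy_def by (rule DERIV_imp_deriv[OF 2])
qed

lemma C1_has_derivative:
  fixes f :: "real \<times> real \<Rightarrow> real"
  assumes "C1 f"
  shows "(f has_derivative (\<lambda>h. fst h * dx f p + snd h * dy f p)) (at p)"
proof -
  obtain f' where f': "(f has_derivative blinfun_apply (f' p)) (at p)"
    using assms unfolding C1_def by blast
  have "blinfun_apply (f' p) h = fst h * dx f p + snd h * dy f p" for h
  proof -
    have "blinfun_apply (f' p) h = blinfun_apply (f' p) (fst h *\<^sub>R (1, 0) + snd h *\<^sub>R (0, 1))"
      by (simp add: scaleR_prod_def)
    then show ?thesis
      unfolding has_derivative_imp_dx_dy(2)[OF f'] has_derivative_imp_dx_dy(4)[OF f']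
      by (simp only: blinfun.add_right blinfun.scaleR_right real_scaleR_def)
  qed
  then have "blinfun_apply (f' p) = (\<lambda>h. fst h * dx f p + snd h * dy f p)" by blast
  then show ?thesis using f' by simp
qed

lemma C1_continuous_dx: "C1 f \<Longrightarrow> continuous_on S (dx f)"
  and C1_continuous_dy: "C1 f \<Longrightarrow> continuous_on S (dy f)"
proof -
  assume "C1 f"
  then obtain f' where f': "\<And>p. (f has_derivative blinfun_apply (f' p)) (at p)"
    and c: "continuous_on UNIV f'"
    unfolding C1_def by blast
  have "dx f = (\<lambda>p. blinfun_apply (f' p) (1, 0))" "dy f = (\<lambda>p. blinfun_apply (f' p) (0, 1))"
    using has_derivative_imp_dx_dy(2)[OF f'] has_derivative_imp_dx_dy(4)[OF f'] by blast+
  moreover have "continuous_on S f'" using c continuous_on_subset by blast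
  ultimately show "continuous_on S (dx f)" "continuous_on S (dy f)"
    by (auto intro!: continuous_intros)
qed

lemma C1_continuous:
  fixes f :: "'a::real_normed_vector \<Rightarrow> 'b::real_normed_vector"
  assumes "C1 f" shows "continuous_on S f"
proof -
  obtain f' where "\<And>x. (f has_derivative blinfun_apply (f' x)) (at x)"
    using assms unfolding C1_def by blast
  then have "isCont f x" for x by (rule has_derivative_continuous)
  then show ?thesis by (simp add: continuous_at_imp_continuous_on)
qed

lemma C1_has_field_derivative:
  fixes f :: "real \<times> real \<Rightarrow> real"
  assumes "C1 f"
  shows "((\<lambda>t. f (t, y)) has_field_derivative dx f (x, y)) (at x)"
    "((\<lambda>t. f (x, t)) has_field_derivative dy f (x, y)) (at y)"
  using has_derivative_imp_dx_dy(1,3)[OF C1_has_derivative[OF assms], of "(x, y)"] by simp_all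

text \<open>One Frechet derivative with continuous coefficients settles regularity and both partial
  derivatives together; the calculus rules below only exhibit their coefficients.\<close>

lemma C1I:
  fixes f :: "real \<times> real \<Rightarrow> real"
  assumes "\<And>p. (f has_derivative (\<lambda>h. fst h * a p + snd h * b p)) (at p)"
    and "continuous_on UNIV a" "continuous_on UNIV b"
  shows "C1 f" "dx f = a" "dy f = b"
proof -
  define f' :: "real \<times> real \<Rightarrow> (real \<times> real) \<Rightarrow>\<^sub>L real"
    where "f' p = a p *\<^sub>R fst_blinfun + b p *\<^sub>R snd_blinfun" for p
  have "blinfun_apply (f' p) = (\<lambda>h. fst h * a p + snd h * b p)" for p
    by (auto simp: f'_def blinfun.add_left blinfun.scaleR_left)
  moreover have "continuous_on UNIV f'"
    unfolding f'_def by (intro continuous_intros assms)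
  ultimately show "C1 f" unfolding C1_def using assms(1) by (intro exI[of _ f']) auto
  show "dx f = a" "dy f = b"
    using has_derivative_imp_dx_dy(2,4)[OF assms(1)] by auto
qed

lemma C1_compose_bounded_linear:
  fixes f :: "'a::real_normed_vector \<Rightarrow> 'b::real_normed_vector"
    and T :: "'b \<Rightarrow> 'c::real_normed_vector"
  assumes "C1 f" "bounded_linear T"
  shows "C1 (\<lambda>x. T (f x))"
proof -
  obtain f' where f': "\<And>x. (f has_derivative blinfun_apply (f' x)) (at x)" "continuous_on UNIV f'"
    using assms(1) unfolding C1_def by blast
  let ?D = "\<lambda>x. Blinfun T o\<^sub>L f' x"
  have "blinfun_apply (?D x) = (\<lambda>h. T (blinfun_apply (f' x) h))" for x
    by (simp add: fun_eq_iff bounded_linear_Blinfun_apply[OF assms(2)])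
  then have "((\<lambda>x. T (f x)) has_derivative blinfun_apply (?D x)) (at x)" for x
    using bounded_linear.has_derivative[OF assms(2) f'(1)[of x]] by (simp only:)
  moreover have "continuous_on UNIV ?D"
    by (intro continuous_intros f')
  ultimately show ?thesis unfolding C1_def by (intro exI[of _ ?D]) auto
qed

section \<open>Calculus rules for the partial derivatives of C1 functions\<close>

lemma C1_const: "C1 (\<lambda>p::real \<times> real. c::real)"
  "dx (\<lambda>p. c) = (\<lambda>p. 0)" "dy (\<lambda>p. c) = (\<lambda>p. 0)"
  by (rule C1I[where a = "\<lambda>p. 0" and b = "\<lambda>p. 0"]; auto)+

lemma C1_fst: "C1 (fst :: real \<times> real \<Rightarrow> real)"
  "dx fst = (\<lambda>p. 1)" "dy fst = (\<lambda>p. 0)"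
  by (rule C1I[where a = "\<lambda>p. 1" and b = "\<lambda>p. 0"]; auto intro!: derivative_eq_intros)+

lemma C1_snd: "C1 (snd :: real \<times> real \<Rightarrow> real)"
  "dx snd = (\<lambda>p. 0)" "dy snd = (\<lambda>p. 1)"
  by (rule C1I[where a = "\<lambda>p. 0" and b = "\<lambda>p. 1"]; auto intro!: derivative_eq_intros)+

lemma C1_add:
  fixes f g :: "real \<times> real \<Rightarrow> real"
  assumes "C1 f" "C1 g"
  shows "C1 (\<lambda>p. f p + g p)" "dx (\<lambda>p. f p + g p) = (\<lambda>p. dx f p + dx g p)"
    "dy (\<lambda>p. f p + g p) = (\<lambda>p. dy f p + dy g p)"
proof -
  have 1: "((\<lambda>p. f p + g p) has_derivative
      (\<lambda>h. fst h * (dx f p + dx g p) + snd h * (dy f p + dy g p))) (at p)" for p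
    by (rule has_derivative_eq_rhs[OF has_derivative_add[OF assms[THEN C1_has_derivative]]])
       (simp add: algebra_simps)
  have 2: "continuous_on UNIV (\<lambda>p. dx f p + dx g p)" "continuous_on UNIV (\<lambda>p. dy f p + dy g p)"
    by (intro continuous_on_add C1_continuous_dx C1_continuous_dy assms)+
  show "C1 (\<lambda>p. f p + g p)" "dx (\<lambda>p. f p + g p) = (\<lambda>p. dx f p + dx g p)"
    "dy (\<lambda>p. f p + g p) = (\<lambda>p. dy f p + dy g p)"
    by (rule C1I[OF 1 2])+
qed

lemma C1_mult:
  fixes f g :: "real \<times> real \<Rightarrow> real"
  assumes "C1 f" "C1 g"
  shows "C1 (\<lambda>p. f p * g p)" "dx (\<lambda>p. f p * g p) = (\<lambda>p. dx f p * g p + f p * dx g p)"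
    "dy (\<lambda>p. f p * g p) = (\<lambda>p. dy f p * g p + f p * dy g p)"
proof -
  have 1: "((\<lambda>p. f p * g p) has_derivative
      (\<lambda>h. fst h * (dx f p * g p + f p * dx g p) + snd h * (dy f p * g p + f p * dy g p))) (at p)" for p
    by (rule has_derivative_eq_rhs[OF has_derivative_mult[OF assms[THEN C1_has_derivative]]])
       (simp add: algebra_simps)
  have 2: "continuous_on UNIV (\<lambda>p. dx f p * g p + f p * dx g p)"
    "continuous_on UNIV (\<lambda>p. dy f p * g p + f p * dy g p)"
    by (intro continuous_on_add continuous_on_mult C1_continuous_dx C1_continuous_dy C1_continuous assms)+
  show "C1 (\<lambda>p. f p * g p)" "dx (\<lambda>p. f p * g p) = (\<lambda>p. dx f p * g p + f p * dx g p)"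
    "dy (\<lambda>p. f p * g p) = (\<lambda>p. dy f p * g p + f p * dy g p)"
    by (rule C1I[OF 1 2])+
qed

lemma C1_sum:
  fixes f :: "'i \<Rightarrow> real \<times> real \<Rightarrow> real"
  assumes "\<And>i. C1 (f i)"
  shows "C1 (\<lambda>p. \<Sum>i\<in>I. f i p)" "dx (\<lambda>p. \<Sum>i\<in>I. f i p) = (\<lambda>p. \<Sum>i\<in>I. dx (f i) p)"
    "dy (\<lambda>p. \<Sum>i\<in>I. f i p) = (\<lambda>p. \<Sum>i\<in>I. dy (f i) p)"
proof -
  have 1: "((\<lambda>p. \<Sum>i\<in>I. f i p) has_derivative
      (\<lambda>h. fst h * (\<Sum>i\<in>I. dx (f i) p) + snd h * (\<Sum>i\<in>I. dy (f i) p))) (at p)" for p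
    by (rule has_derivative_eq_rhs[OF has_derivative_sum[OF C1_has_derivative[OF assms]]])
       (simp add: sum.distrib sum_distrib_left)
  have 2: "continuous_on UNIV (\<lambda>p. \<Sum>i\<in>I. dx (f i) p)" "continuous_on UNIV (\<lambda>p. \<Sum>i\<in>I. dy (f i) p)"
    by (intro continuous_on_sum C1_continuous_dx C1_continuous_dy assms)+
  show "C1 (\<lambda>p. \<Sum>i\<in>I. f i p)" "dx (\<lambda>p. \<Sum>i\<in>I. f i p) = (\<lambda>p. \<Sum>i\<in>I. dx (f i) p)"
    "dy (\<lambda>p. \<Sum>i\<in>I. f i p) = (\<lambda>p. \<Sum>i\<in>I. dy (f i) p)"
    by (rule C1I[OF 1 2])+
qed

lemma C1_comp:
  fixes f :: "real \<times> real \<Rightarrow> real" and g g' :: "real \<Rightarrow> real"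
  assumes "C1 f" "\<And>t. (g has_field_derivative g' t) (at t)" "continuous_on UNIV g'"
  shows "C1 (\<lambda>p. g (f p))" "dx (\<lambda>p. g (f p)) = (\<lambda>p. g' (f p) * dx f p)"
    "dy (\<lambda>p. g (f p)) = (\<lambda>p. g' (f p) * dy f p)"
proof -
  have 1: "((\<lambda>p. g (f p)) has_derivative
      (\<lambda>h. fst h * (g' (f p) * dx f p) + snd h * (g' (f p) * dy f p))) (at p)" for p
    by (rule has_derivative_eq_rhs[OF has_derivative_compose[OF C1_has_derivative[OF assms(1)]
          assms(2)[unfolded has_field_derivative_def]]])
       (auto simp: algebra_simps)
  have "continuous_on UNIV (\<lambda>p. g' (f p))"
    using continuous_on_compose2[OF assms(3) C1_continuous[OF assms(1)]] by auto
  then have 2: "continuous_on UNIV (\<lambda>p. g' (f p) * dx f p)" "continuous_on UNIV (\<lambda>p. g' (f p) * dy f p)"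
    by (rule continuous_on_mult[OF _ C1_continuous_dx[OF assms(1)]]
      continuous_on_mult[OF _ C1_continuous_dy[OF assms(1)]]; assumption)+
  show "C1 (\<lambda>p. g (f p))" "dx (\<lambda>p. g (f p)) = (\<lambda>p. g' (f p) * dx f p)"
    "dy (\<lambda>p. g (f p)) = (\<lambda>p. g' (f p) * dy f p)"
    by (rule C1I[OF 1 2])+
qed

lemma C2_coord:
  fixes u :: "real \<times> real \<Rightarrow> real^'m"
  assumes "C2 u"
  shows "C1 (coord u i)" "C1 (dx (coord u i))" "C1 (dy (coord u i))"
proof -
  obtain f' where f': "\<And>x. (u has_derivative blinfun_apply (f' x)) (at x)" "C1 f'"
    using assms unfolding C2_def by blast
  have "C1 u" unfolding C1_def using f' C1_continuous by blast
  then show "C1 (coord u i)"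
    by (rule C1_compose_bounded_linear) (rule bounded_linear_vec_nth)
  have D: "(coord u i has_derivative (\<lambda>h. blinfun_apply (f' p) h $ i)) (at p)" for p
    by (rule bounded_linear.has_derivative[OF bounded_linear_vec_nth f'(1)])
  have "dx (coord u i) = (\<lambda>p. blinfun_apply (f' p) (1, 0) $ i)"
    "dy (coord u i) = (\<lambda>p. blinfun_apply (f' p) (0, 1) $ i)"
    using has_derivative_imp_dx_dy(2,4)[OF D] by auto
  moreover have "bounded_linear (\<lambda>L. blinfun_apply L v $ i)"
    for v :: "real \<times> real" 
    by (rule bounded_linear_compose[OF bounded_linear_vec_nth
          blinfun.bounded_linear_left])
  ultimately show "C1 (dx (coord u i))" "C1 (dy (coord u i))"
    using C1_compose_bounded_linear[OF f'(2)] by auto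
qed

text \<open>Schwarz's theorem: the second difference of \<open>f\<close> over a small square,
  computed in either order by two mean value steps, is \<open>h * h\<close> times a mixed derivative
  at some point of the square.\<close>

lemma dx_dy_commute:
  fixes f :: "real \<times> real \<Rightarrow> real"
  assumes f: "C1 f" "C1 (dx f)" "C1 (dy f)"
  shows "dy (dx f) p = dx (dy f) p"
proof (rule ccontr)
  assume ne: "dy (dx f) p \<noteq> dx (dy f) p"
  \<comment> \<open>Half the gap: two mixed derivatives that stay within \<open>e\<close> of their
    values at \<open>p\<close> cannot coincide.\<close>
  define e where "e = \<bar>dy (dx f) p - dx (dy f) p\<bar> / 2"
  have "e > 0" using ne by (simp add: e_def)
  have cont: "isCont (dy (dx f)) p" "isCont (dx (dy f)) p"
    using C1_continuous_dy[OF f(2), of UNIV] C1_continuous_dx[OF f(3), of UNIV]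
    unfolding continuous_on_eq_continuous_at[OF open_UNIV] by blast+
  obtain x y where p: "p = (x, y)" by force
  obtain d1 where d1: "d1 > 0" "\<And>q. dist q p < d1 \<Longrightarrow> dist (dy (dx f) q) (dy (dx f) p) < e"
    using cont(1) \<open>e > 0\<close> unfolding continuous_at_eps_delta by blast
  obtain d2 where d2: "d2 > 0" "\<And>q. dist q p < d2 \<Longrightarrow> dist (dx (dy f) q) (dx (dy f) p) < e"
    using cont(2) \<open>e > 0\<close> unfolding continuous_at_eps_delta by blast
  define h where "h = min d1 d2 / 3"
  have h: "h > 0" "2 * h < d1" "2 * h < d2" using d1(1) d2(1) by (auto simp: h_def min_def)
  have near: "dist (s, t) p \<le> 2 * h" if "x \<le> s" "s \<le> x + h" "y \<le> t" "t \<le> y + h" for s t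
  proof -
    have "dist (s, t) p \<le> \<bar>s - x\<bar> + \<bar>t - y\<bar>"
      unfolding p dist_Pair_Pair dist_real_def using sqrt_sum_squares_le_sum_abs by simp
    then show ?thesis using that by auto
  qed
  define D where "D = f (x + h, y + h) - f (x + h, y) - f (x, y + h) + f (x, y)"
  have "\<exists>s. x < s \<and> s < x + h \<and> (f (x + h, y + h) - f (x + h, y)) - (f (x, y + h) - f (x, y))
      = ((x + h) - x) * (dx f (s, y + h) - dx f (s, y))"
    by (rule MVT2[of x "x + h" "\<lambda>s. f (s, y + h) - f (s, y)"])
       (use h in \<open>auto intro!: derivative_eq_intros C1_has_field_derivative f\<close>)
  then obtain s where s: "x < s" "s < x + h" "D = h * (dx f (s, y + h) - dx f (s, y))"
    unfolding D_def by auto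
  have "\<exists>t. y < t \<and> t < y + h \<and> dx f (s, y + h) - dx f (s, y) = ((y + h) - y) * dy (dx f) (s, t)"
    by (rule MVT2) (use h in \<open>auto intro!: C1_has_field_derivative f\<close>)
  then obtain t where t: "y < t" "t < y + h" "D = h * (h * dy (dx f) (s, t))"
    using s(3) by auto
  have "\<exists>t. y < t \<and> t < y + h \<and> (f (x + h, y + h) - f (x, y + h)) - (f (x + h, y) - f (x, y))
      = ((y + h) - y) * (dy f (x + h, t) - dy f (x, t))"
    by (rule MVT2[of y "y + h" "\<lambda>t. f (x + h, t) - f (x, t)"])
       (use h in \<open>auto intro!: derivative_eq_intros C1_has_field_derivative f\<close>)
  then obtain t' where t': "y < t'" "t' < y + h" "D = h * (dy f (x + h, t') - dy f (x, t'))"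
    unfolding D_def by auto
  have "\<exists>s. x < s \<and> s < x + h \<and> dy f (x + h, t') - dy f (x, t') = ((x + h) - x) * dx (dy f) (s, t')"
    by (rule MVT2) (use h in \<open>auto intro!: C1_has_field_derivative f\<close>)
  then obtain s' where s': "x < s'" "s' < x + h" "D = h * (h * dx (dy f) (s', t'))"
    using t'(3) by auto
  have "dy (dx f) (s, t) = dx (dy f) (s', t')"
    using t(3) s'(3) h by auto
  moreover have "dist (dy (dx f) (s, t)) (dy (dx f) p) < e"
    by (rule d1(2)) (use near[of s t] s t h in auto)
  moreover have "dist (dx (dy f) (s', t')) (dx (dy f) p) < e"
    by (rule d2(2)) (use near[of s' t'] s' t' h in auto)
  ultimately show False unfolding e_def dist_real_def by (simp add: abs_if split: if_splits)
qed

section \<open>Integration by parts\<close>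

lemma dx_dy_cong:
  assumes "open S" "p \<in> S" "\<And>q. q \<in> S \<Longrightarrow> f q = g q"
  shows "dx f p = dx g p" "dy f p = dy g p"
proof -
  have "open ((\<lambda>t. (t, snd p)) -` S)" "open ((\<lambda>t. (fst p, t)) -` S)"
    using assms(1) by (auto intro!: continuous_open_vimage continuous_intros)
  then have "eventually (\<lambda>t. (t, snd p) \<in> S) (nhds (fst p))"
    "eventually (\<lambda>t. (fst p, t) \<in> S) (nhds (snd p))"
    using eventually_nhds_in_open[of "(\<lambda>t. (t, snd p)) -` S" "fst p"]
      eventually_nhds_in_open[of "(\<lambda>t. (fst p, t)) -` S" "snd p"] assms(2) by auto
  then have ev: "eventually (\<lambda>t. f (t, snd p) = g (t, snd p)) (nhds (fst p))"
    "eventually (\<lambda>t. f (fst p, t) = g (fst p, t)) (nhds (snd p))"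
    using assms(3) by (auto elim: eventually_mono)
  show "dx f p = dx g p"
    unfolding dx_def by (rule deriv_cong_ev[OF ev(1) refl])
  show "dy f p = dy g p"
    unfolding dy_def by (rule deriv_cong_ev[OF ev(2) refl])
qed

section \<open>Functions with bounded support and their integrals\<close>

lemma bounded_supportE:
  fixes f :: "real \<times> real \<Rightarrow> real"
  assumes "bounded {p. f p \<noteq> 0}"
  obtains R where "R > 0" "\<And>p. norm p > R \<Longrightarrow> f p = 0"
  using assms unfolding bounded_pos by (metis (mono_tags) linorder_not_less mem_Collect_eq)

lemma bounded_supportI:
  fixes f :: "real \<times> real \<Rightarrow> real"
  assumes "\<And>p. norm p > R \<Longrightarrow> f p = 0"
  shows "bounded {p. f p \<noteq> 0}"
  unfolding bounded_iff using assms by (metis (mono_tags) linorder_not_less mem_Collect_eq)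

lemma dx_dy_eq_0_outside:
  fixes f :: "real \<times> real \<Rightarrow> real"
  assumes "\<And>p. norm p > R \<Longrightarrow> f p = 0" "norm p > R"
  shows "dx f p = 0" "dy f p = 0"
proof -
  have "open {p :: real \<times> real. norm p > R}" by (intro open_Collect_less continuous_intros)
  from dx_dy_cong[OF this, of p f "\<lambda>p. 0"] assms C1_const(2,3)[of 0]
  show "dx f p = 0" "dy f p = 0" by auto
qed

lemma bounded_support_dx: "bounded {p. f p \<noteq> 0} \<Longrightarrow> bounded {p. dx f p \<noteq> 0}"
  and bounded_support_dy: "bounded {p. f p \<noteq> 0} \<Longrightarrow> bounded {p. dy f p \<noteq> 0}"
  by (erule bounded_supportE, rule bounded_supportI, erule (1) dx_dy_eq_0_outside)+

lemma bounded_support_mult: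
  fixes f g :: "real \<times> real \<Rightarrow> real"
  shows "bounded {p. f p \<noteq> 0} \<Longrightarrow> bounded {p. f p * g p \<noteq> 0}"
    "bounded {p. g p \<noteq> 0} \<Longrightarrow> bounded {p. f p * g p \<noteq> 0}"
  by (auto elim: bounded_subset)

lemma integrable_bounded_support:
  fixes f :: "real \<times> real \<Rightarrow> real"
  assumes "continuous_on UNIV f" "bounded {p. f p \<noteq> 0}"
  shows "integrable lborel f"
proof -
  obtain R where R: "\<And>p. norm p > R \<Longrightarrow> f p = 0"
    using bounded_supportE[OF assms(2)] by blast
  have "integrable lborel (\<lambda>p. indicator (cball 0 R) p *\<^sub>R f p)"
    by (rule borel_integrable_compact[OF compact_cball continuous_on_subset[OF assms(1)]]) auto
  also have "(\<lambda>p. indicator (cball 0 R) p *\<^sub>R f p) = f"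
    using R by (auto simp: indicator_def fun_eq_iff)
  finally show ?thesis .
qed

lemma integral_translate:
  fixes f :: "real \<times> real \<Rightarrow> real"
  assumes "continuous_on UNIV f"
  shows "(LINT p|lborel. f (p + v)) = (LINT p|lborel. f p)"
proof -
  have "(LINT p|lborel. f p) = (LINT p|distr lborel borel ((+) v). f p)"
    by (simp only: lborel_distr_plus)
  also have "\<dots> = (LINT p|lborel. f (v + p))"
    by (rule integral_distr) (auto intro: borel_measurable_continuous_onI assms)
  finally show ?thesis by (simp add: add.commute)
qed

lemma C1_translate:
  fixes f :: "real \<times> real \<Rightarrow> real"
  assumes "C1 f"
  shows "C1 (\<lambda>p. f (p + v))" "dx (\<lambda>p. f (p + v)) = (\<lambda>p. dx f (p + v))"
    "dy (\<lambda>p. f (p + v)) = (\<lambda>p. dy f (p + v))"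
proof -
  have 1: "((\<lambda>p. f (p + v)) has_derivative
      (\<lambda>h. fst h * dx f (p + v) + snd h * dy f (p + v))) (at p)" for p
    using has_derivative_compose[OF has_derivative_add[OF has_derivative_ident has_derivative_const]
        C1_has_derivative[OF assms], of v p] by simp
  have 2: "continuous_on UNIV (\<lambda>p. dx f (p + v))" "continuous_on UNIV (\<lambda>p. dy f (p + v))"
    by (rule continuous_on_compose2[OF C1_continuous_dx[OF assms, of UNIV]]
        continuous_on_compose2[OF C1_continuous_dy[OF assms, of UNIV]];
        auto intro!: continuous_intros)+
  show "C1 (\<lambda>p. f (p + v))" "dx (\<lambda>p. f (p + v)) = (\<lambda>p. dx f (p + v))"
    "dy (\<lambda>p. f (p + v)) = (\<lambda>p. dy f (p + v))"
    by (rule C1I[OF 1 2])+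
qed

text \<open>The mean value inequality on a convex compact set. It supplies the dominating functions
  when difference quotients pass to the limit under the integral.\<close>

lemma C1_lipschitz_cball:
  fixes f :: "real \<times> real \<Rightarrow> real"
  assumes "C1 f"
  obtains B where "B \<ge> 0" "\<And>p q. norm p \<le> R \<Longrightarrow> norm q \<le> R \<Longrightarrow> \<bar>f p - f q\<bar> \<le> B * norm (p - q)"
proof -
  have "compact ((\<lambda>p. \<bar>dx f p\<bar> + \<bar>dy f p\<bar>) ` cball 0 R)"
    by (intro compact_continuous_image continuous_intros C1_continuous_dx C1_continuous_dy assms) auto
  then obtain B where B: "B > 0" "\<And>p. norm p \<le> R \<Longrightarrow> \<bar>dx f p\<bar> + \<bar>dy f p\<bar> \<le> B"
    using compact_imp_bounded bounded_pos[of "(\<lambda>p. \<bar>dx f p\<bar> + \<bar>dy f p\<bar>) ` cball 0 R"]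
    by (auto simp: image_iff)
  have "norm (f p - f q) \<le> B * norm (p - q)" if "norm p \<le> R" "norm q \<le> R" for p q
  proof (rule differentiable_bound[of "cball 0 R"])
    fix r :: "real \<times> real" assume r: "r \<in> cball 0 R"
    show "(f has_derivative (\<lambda>h. fst h * dx f r + snd h * dy f r)) (at r within cball 0 R)"
      by (rule has_derivative_at_withinI[OF C1_has_derivative[OF assms]])
    show "onorm (\<lambda>h. fst h * dx f r + snd h * dy f r) \<le> B"
    proof (rule onorm_bound)
      fix h :: "real \<times> real"
      have "\<bar>fst h * dx f r + snd h * dy f r\<bar> \<le> \<bar>fst h\<bar> * \<bar>dx f r\<bar> + \<bar>snd h\<bar> * \<bar>dy f r\<bar>"
        by (metis abs_mult abs_triangle_ineq)
      also have "\<dots> \<le> norm h * \<bar>dx f r\<bar> + norm h * \<bar>dy f r\<bar>"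
        using norm_fst_le[of "fst h" "snd h"] norm_snd_le[of "snd h" "fst h"]
        by (intro add_mono mult_right_mono) auto
      also have "\<dots> = (\<bar>dx f r\<bar> + \<bar>dy f r\<bar>) * norm h" by (simp add: algebra_simps)
      also have "\<dots> \<le> B * norm h"
        using B(2)[of r] r by (intro mult_right_mono) auto
      finally show "norm (fst h * dx f r + snd h * dy f r) \<le> B * norm h" by simp
    qed (use B in auto)
  qed (use that in auto)
  then show ?thesis using B(1) by (intro that[of B]) auto
qed

lemma difference_quotient_tendsto:
  fixes f :: "real \<times> real \<Rightarrow> real"
  assumes "C1 f" "h \<longlonglongrightarrow> 0" "\<And>n. h n \<noteq> 0"
  shows "(\<lambda>n. (f (p + h n *\<^sub>R e) - f p) / h n) \<longlonglongrightarrow> fst e * dx f p + snd e * dy f p"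
proof -
  have "((\<lambda>t. p + t *\<^sub>R e) has_derivative (\<lambda>t. t *\<^sub>R e)) (at 0)"
    by (auto intro!: derivative_eq_intros)
  from has_derivative_compose[OF this C1_has_derivative[OF assms(1)]]
  have "((\<lambda>t. f (p + t *\<^sub>R e)) has_derivative (\<lambda>t. t * (fst e * dx f p + snd e * dy f p))) (at 0)"
    by (simp add: algebra_simps)
  then have "((\<lambda>t. f (p + t *\<^sub>R e)) has_field_derivative fst e * dx f p + snd e * dy f p) (at 0)"
    by (simp add: has_field_derivative_def mult_commute_abs)
  then have "(\<lambda>t. (f (p + t *\<^sub>R e) - f p) / t) \<midarrow>0\<rightarrow> fst e * dx f p + snd e * dy f p"
    by (simp add: DERIV_def)
  then show ?thesis
    by (rule filterlim_compose) (use assms in \<open>auto intro!: filterlim_atI\<close>)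
qed

text \<open>Translation invariance makes the integral of every difference quotient vanish, and
  dominated convergence carries this over to the derivative without iterated integrals.\<close>

lemma integral_dx_dy_eq_0:
  fixes f :: "real \<times> real \<Rightarrow> real"
  assumes f: "C1 f" "bounded {p. f p \<noteq> 0}"
  shows "(LINT p|lborel. dx f p) = 0" "(LINT p|lborel. dy f p) = 0"
proof -
  have *: "(LINT p|lborel. fst e * dx f p + snd e * dy f p) = 0"
    if e: "norm e \<le> 1" for e :: "real \<times> real"
  proof -
    obtain R where R: "R > 0" "\<And>p. norm p > R \<Longrightarrow> f p = 0"
      using bounded_supportE[OF f(2)] by blast
    \<comment> \<open>The quotients vanish outside radius \<open>R + 1\<close> and shifts have
      length at most 1, so both points compared lie within radius \<open>R + 2\<close>.\<close>
    obtain B where B: "B \<ge> 0"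
      "\<And>p q. norm p \<le> R + 2 \<Longrightarrow> norm q \<le> R + 2 \<Longrightarrow> \<bar>f p - f q\<bar> \<le> B * norm (p - q)"
      using C1_lipschitz_cball[OF f(1)] by blast
    define h where "h n = inverse (real (Suc n))" for n
    have h: "h n > 0" "h n \<le> 1" for n by (auto simp: h_def field_simps)
    have lim: "h \<longlonglongrightarrow> 0" unfolding h_def by (rule LIMSEQ_inverse_real_of_nat)
    define s where "s n p = (f (p + h n *\<^sub>R e) - f p) / h n" for n p
    have cf: "continuous_on UNIV (\<lambda>p. f (p + v))" for v
      by (rule C1_continuous[OF C1_translate(1)[OF f(1)]])
    have "(LINT p|lborel. s n p) = 0" for n
    proof -
      have "integrable lborel f" by (rule integrable_bounded_support[OF C1_continuous[OF f(1)] f(2)])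
      moreover have "integrable lborel (\<lambda>p. f (p + h n *\<^sub>R e))"
      proof (rule integrable_bounded_support[OF cf bounded_supportI])
        fix p :: "real \<times> real" assume p: "norm p > R + 1"
        have "norm p \<le> norm (p + h n *\<^sub>R e) + norm (h n *\<^sub>R e)"
          using norm_triangle_ineq4[of "p + h n *\<^sub>R e" "h n *\<^sub>R e"] by simp
        moreover have "norm (h n *\<^sub>R e) \<le> 1"
          using h[of n] e by (simp add: mult_le_one)
        ultimately show "f (p + h n *\<^sub>R e) = 0" using p R(2) by auto
      qed
      ultimately show ?thesis
        using integral_translate[OF C1_continuous[OF f(1)], of "h n *\<^sub>R e"]
        by (simp add: s_def)
    qed
    moreover have "(\<lambda>n. LINT p|lborel. s n p) \<longlonglongrightarrow> (LINT p|lborel. fst e * dx f p + snd e * dy f p)"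
    proof (rule integral_dominated_convergence[where w = "\<lambda>p. indicator (cball 0 (R + 1)) p *\<^sub>R B"])
      show "integrable lborel (\<lambda>p::real \<times> real. indicator (cball 0 (R + 1)) p *\<^sub>R B)"
        by (rule borel_integrable_compact) auto
      show "AE p in lborel. (\<lambda>n. s n p) \<longlonglongrightarrow> fst e * dx f p + snd e * dy f p"
        unfolding s_def using h by (intro always_eventually allI difference_quotient_tendsto[OF f(1) lim])
          (metis less_irrefl)
      show "AE p in lborel. norm (s n p) \<le> indicator (cball 0 (R + 1)) p *\<^sub>R B" for n
      proof (intro always_eventually allI)
        fix p :: "real \<times> real"
        have he: "norm (h n *\<^sub>R e) \<le> h n" 
          using h[of n] e by (simp add: mult_left_le)
        show "norm (s n p) \<le> indicator (cball 0 (R + 1)) p *\<^sub>R B"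
        proof (cases "norm p \<le> R + 1")
          case True
          then have "norm (p + h n *\<^sub>R e) \<le> R + 2"
            using norm_triangle_ineq[of p "h n *\<^sub>R e"] he h[of n] by linarith
          then have "\<bar>f (p + h n *\<^sub>R e) - f p\<bar> \<le> B * norm (h n *\<^sub>R e)"
            using B(2)[of "p + h n *\<^sub>R e" p] True by simp
          also have "\<dots> \<le> B * h n" using he B(1) by (rule mult_left_mono)
          finally show ?thesis
            using True h(1)[of n] by (simp add: s_def abs_divide pos_divide_le_eq)
        next
          case False
          have "norm p \<le> norm (p + h n *\<^sub>R e) + norm (h n *\<^sub>R e)"
            using norm_triangle_ineq4[of "p + h n *\<^sub>R e" "h n *\<^sub>R e"] by simp
          then have "norm (p + h n *\<^sub>R e) > R" using False he h[of n] by linarith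
          then show ?thesis using False R(2) B(1) by (simp add: s_def)
        qed
      qed
      have "continuous_on UNIV (\<lambda>p. fst e * dx f p + snd e * dy f p)"
        by (intro continuous_intros C1_continuous_dx C1_continuous_dy f)
      then show "(\<lambda>p. fst e * dx f p + snd e * dy f p) \<in> borel_measurable lborel"
        by (auto intro: borel_measurable_continuous_onI)
      have "continuous_on UNIV (s n)" for n
        unfolding s_def using h(1)[of n]
        by (intro continuous_intros cf C1_continuous[OF f(1)]) auto
      then show "s n \<in> borel_measurable lborel" for n
        by (auto intro: borel_measurable_continuous_onI)
    qed
    ultimately show ?thesis by (simp add: LIMSEQ_const_iff)
  qed
  show "(LINT p|lborel. dx f p) = 0" using *[of "(1, 0)"] by (simp add: norm_Pair)
  show "(LINT p|lborel. dy f p) = 0" using *[of "(0, 1)"] by (simp add: norm_Pair)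
qed

text \<open>Only first derivatives of \<open>w\<close> and \<open>\<psi>\<close> are available, so \<open>\<psi>\<^sub>y\<close> is replaced by a
  difference quotient, which may be differentiated once more in \<open>x\<close>.\<close>

lemma integral_jacobian:
  fixes w \<psi> :: "real \<times> real \<Rightarrow> real"
  assumes w: "C1 w" and \<psi>: "C1 \<psi>" "bounded {p. \<psi> p \<noteq> 0}"
  shows "(LINT p|lborel. fst p * (dx w p * dy \<psi> p - dy w p * dx \<psi> p)) = (LINT p|lborel. dy w p * \<psi> p)"
proof -
  obtain R where R: "R > 0" "\<And>p. norm p > R \<Longrightarrow> \<psi> p = 0"
    using bounded_supportE[OF \<psi>(2)] by blast
  have R': "norm p > R \<Longrightarrow> dx \<psi> p = 0" for p
    by (rule dx_dy_eq_0_outside[OF R(2)])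
  define h where "h n = inverse (real (Suc n))" for n
  have h: "h n > 0" "h n \<le> 1" for n by (auto simp: h_def field_simps)
  have lim: "h \<longlonglongrightarrow> 0" unfolding h_def by (rule LIMSEQ_inverse_real_of_nat)
  define e :: "real \<times> real" where "e = (0, 1)"
  have ne: "norm (h n *\<^sub>R e) = h n" for n using h(1)[of n] by (simp add: e_def norm_Pair)
  \<comment> \<open>\<open>k\<close> is the x-derivative of \<open>fst p * w p\<close>.
    \<open>D\<close> is the forward vertical quotient of \<open>\<psi>\<close> and \<open>D'\<close>
    the backward one of \<open>w\<close>: moving a quotient to the other factor reverses its
    direction.\<close>
  define k where "k p = w p + fst p * dx w p" for p
  define D where "D n p = (\<psi> (p + h n *\<^sub>R e) + (- 1) * \<psi> p) * (1 / h n)" for n p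
  define D' where "D' n p = (w p - w (p + (- h n) *\<^sub>R e)) / h n" for n p
  have nt: "norm p - h n \<le> norm (p + h n *\<^sub>R e)" "norm (p + h n *\<^sub>R e) \<le> norm p + h n"
    "norm (p + (- h n) *\<^sub>R e) \<le> norm p + h n" for n p
    using norm_triangle_ineq4[of "p + h n *\<^sub>R e" "h n *\<^sub>R e"] norm_triangle_ineq[of p "h n *\<^sub>R e"]
      norm_triangle_ineq4[of p "h n *\<^sub>R e"] ne[of n] by auto
  have D0: "D n p = 0" if "norm p > R + 1" for n p
    unfolding D_def using R(2)[of p] R(2)[of "p + h n *\<^sub>R e"] nt(1)[of p n] h(2)[of n] that by auto
  have CD: "C1 (D n)" and dxD: "dx (D n) = (\<lambda>p. (dx \<psi> (p + h n *\<^sub>R e) - dx \<psi> p) * (1 / h n))" for n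
  proof -
    have t: "C1 (\<lambda>p. \<psi> (p + h n *\<^sub>R e))" by (rule C1_translate(1)[OF \<psi>(1)])
    have m: "C1 (\<lambda>p. (- 1) * \<psi> p)" by (rule C1_mult(1)[OF C1_const(1) \<psi>(1)])
    have a: "C1 (\<lambda>p. \<psi> (p + h n *\<^sub>R e) + (- 1) * \<psi> p)" by (rule C1_add(1)[OF t m])
    show "C1 (D n)" unfolding D_def by (rule C1_mult(1)[OF a C1_const(1)])
    show "dx (D n) = (\<lambda>p. (dx \<psi> (p + h n *\<^sub>R e) - dx \<psi> p) * (1 / h n))"
      unfolding D_def C1_mult(2)[OF a C1_const(1)] C1_add(2)[OF t m]
        C1_mult(2)[OF C1_const(1) \<psi>(1)] C1_translate(2)[OF \<psi>(1)] C1_const(2)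
      by simp
  qed
  have ck: "continuous_on UNIV k"
    unfolding k_def by (intro continuous_intros C1_continuous_dx C1_continuous w)
  have cx: "continuous_on UNIV (dx \<psi>)" "continuous_on UNIV (\<lambda>p. dx \<psi> (p + v))" for v
    using C1_continuous_dx[OF \<psi>(1)] C1_continuous_dx[OF C1_translate(1)[OF \<psi>(1)], of UNIV v]
    by (simp_all add: C1_translate(2)[OF \<psi>(1)])
  have cw: "continuous_on UNIV w" "continuous_on UNIV (\<lambda>p. w (p + v))" for v
    using C1_continuous[OF w] C1_continuous[OF C1_translate(1)[OF w]] by auto
  have cD': "continuous_on UNIV (D' n)" for n
    unfolding D'_def using h(1)[of n] by (intro continuous_intros cw) auto
  \<comment> \<open>Integrating the x-derivative of \<open>fst p * w p * D n p\<close> produces the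
    mixed derivative of \<open>\<psi>\<close> only as a vertical quotient of
    \<open>dx \<psi>\<close>; its shift is then moved onto \<open>w\<close>.\<close>
  have eq: "(LINT p|lborel. k p * D n p) = (LINT p|lborel. fst p * dx \<psi> p * D' n p)" for n
  proof -
    define g where "g p = fst p * w p * D n p" for p
    have g: "C1 g" unfolding g_def by (intro C1_mult C1_fst w CD)
    have dg: "dx g p = k p * D n p + (fst p * w p * dx \<psi> (p + h n *\<^sub>R e) - fst p * w p * dx \<psi> p) * (1 / h n)" for p
      unfolding g_def k_def
      by (simp add: C1_mult C1_fst w CD dxD) (simp add: algebra_simps)
    have "bounded {p. g p \<noteq> 0}"
      by (rule bounded_supportI[of "R + 1"]) (simp add: g_def D0)
    then have 0: "(LINT p|lborel. dx g p) = 0" by (rule integral_dx_dy_eq_0[OF g])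
    have i1: "integrable lborel (\<lambda>p. k p * D n p)"
      by (rule integrable_bounded_support, intro continuous_on_mult ck C1_continuous CD,
          rule bounded_supportI[of "R + 1"]) (simp add: D0)
    have i2: "integrable lborel (\<lambda>p. fst p * w p * dx \<psi> p)"
      by (rule integrable_bounded_support, intro continuous_intros cx cw,
          rule bounded_supportI[of R]) (simp add: R')
    have c3: "continuous_on UNIV (\<lambda>p. fst p * w p * dx \<psi> (p + h n *\<^sub>R e))"
      by (intro continuous_intros cx cw)
    have i3: "integrable lborel (\<lambda>p. fst p * w p * dx \<psi> (p + h n *\<^sub>R e))"
    proof (rule integrable_bounded_support[OF c3 bounded_supportI[of "R + 1"]])
      fix p :: "real \<times> real" assume "norm p > R + 1"
      then show "fst p * w p * dx \<psi> (p + h n *\<^sub>R e) = 0"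
        using R'[of "p + h n *\<^sub>R e"] nt(1)[of p n] h(2)[of n] by auto
    qed
    have i4: "integrable lborel (\<lambda>p. fst p * w (p + (- h n) *\<^sub>R e) * dx \<psi> p)"
      by (rule integrable_bounded_support, intro continuous_on_mult continuous_intros cx cw,
          rule bounded_supportI[of R]) (simp add: R')
    \<comment> \<open>The shift is vertical and therefore leaves the factor \<open>fst p\<close>
      alone.\<close>
    have "(LINT p|lborel. fst p * w p * dx \<psi> (p + h n *\<^sub>R e))
        = (LINT p|lborel. fst p * w (p + (- h n) *\<^sub>R e) * dx \<psi> p)"
      using integral_translate[OF c3, of "(- h n) *\<^sub>R e"]
      by (simp add: e_def add.assoc zero_prod_def[symmetric])
    then have "(LINT p|lborel. k p * D n p)
        = (1 / h n) * ((LINT p|lborel. fst p * w p * dx \<psi> p)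
          - (LINT p|lborel. fst p * w (p + (- h n) *\<^sub>R e) * dx \<psi> p))"
      using 0 i1 i2 i3 unfolding dg by (simp add: algebra_simps)
    also have "\<dots> = (LINT p|lborel. (1 / h n) * (fst p * w p * dx \<psi> p - fst p * w (p + (- h n) *\<^sub>R e) * dx \<psi> p))"
      using i2 i4 by simp
    also have "\<dots> = (LINT p|lborel. fst p * dx \<psi> p * D' n p)"
      unfolding D'_def using h(1)[of n] by (intro Bochner_Integration.integral_cong) (auto simp: field_simps)
    finally show ?thesis .
  qed
  have "(\<lambda>n. LINT p|lborel. k p * D n p) \<longlonglongrightarrow> (LINT p|lborel. k p * dy \<psi> p)"
  proof -
    obtain B where B: "B \<ge> 0"
      "\<And>p q. norm p \<le> R + 2 \<Longrightarrow> norm q \<le> R + 2 \<Longrightarrow> \<bar>\<psi> p - \<psi> q\<bar> \<le> B * norm (p - q)"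
      using C1_lipschitz_cball[OF \<psi>(1)] by blast
    show ?thesis
    proof (rule integral_dominated_convergence[where w = "\<lambda>p. indicator (cball 0 (R + 1)) p *\<^sub>R (\<bar>k p\<bar> * B)"])
      show "integrable lborel (\<lambda>p::real \<times> real. indicator (cball 0 (R + 1)) p *\<^sub>R (\<bar>k p\<bar> * B))"
        by (rule borel_integrable_compact)
           (auto intro!: continuous_intros continuous_on_subset[OF ck])
      show "(\<lambda>p. k p * dy \<psi> p) \<in> borel_measurable lborel"
        using continuous_on_mult[OF ck C1_continuous_dy[OF \<psi>(1)]]
        by (auto intro: borel_measurable_continuous_onI)
      show "(\<lambda>p. k p * D n p) \<in> borel_measurable lborel" for n
        using continuous_on_mult[OF ck C1_continuous[OF CD]]
        by (auto intro: borel_measurable_continuous_onI)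
      have "(\<lambda>n. D n p) \<longlonglongrightarrow> dy \<psi> p" for p
        using difference_quotient_tendsto[OF \<psi>(1) lim, of p e] h(1)
        by (simp add: D_def e_def less_imp_neq[THEN not_sym])
      then show "AE p in lborel. (\<lambda>n. k p * D n p) \<longlonglongrightarrow> k p * dy \<psi> p"
        by (intro always_eventually allI tendsto_intros)
      show "AE p in lborel. norm (k p * D n p) \<le> indicator (cball 0 (R + 1)) p *\<^sub>R (\<bar>k p\<bar> * B)" for n
      proof (intro always_eventually allI)
        fix p :: "real \<times> real"
        show "norm (k p * D n p) \<le> indicator (cball 0 (R + 1)) p *\<^sub>R (\<bar>k p\<bar> * B)"
        proof (cases "norm p \<le> R + 1")
          case True
          have "\<bar>\<psi> (p + h n *\<^sub>R e) - \<psi> p\<bar> \<le> B * h n"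
            using B(2)[of "p + h n *\<^sub>R e" p] True nt(2)[of p n] h(2)[of n] ne[of n] by simp
          then have "\<bar>D n p\<bar> \<le> B"
            using h(1)[of n] by (simp add: D_def abs_mult pos_divide_le_eq)
          then show ?thesis using True by (simp add: abs_mult mult_left_mono)
        qed (simp add: D0)
      qed
    qed
  qed
  \<comment> \<open>\<open>w\<close> itself has no bounded support; \<open>dx \<psi>\<close>
    confines \<open>p\<close> to radius \<open>R\<close>, so a Lipschitz bound on radius
    \<open>R + 1\<close> is enough.\<close>
  moreover have "(\<lambda>n. LINT p|lborel. fst p * dx \<psi> p * D' n p) \<longlonglongrightarrow> (LINT p|lborel. fst p * dx \<psi> p * dy w p)"
  proof -
    obtain B where B: "B \<ge> 0"
      "\<And>p q. norm p \<le> R + 1 \<Longrightarrow> norm q \<le> R + 1 \<Longrightarrow> \<bar>w p - w q\<bar> \<le> B * norm (p - q)"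
      using C1_lipschitz_cball[OF w] by blast
    have cf: "continuous_on UNIV (\<lambda>p. fst p * dx \<psi> p)" by (intro continuous_intros cx)
    show ?thesis
    proof (rule integral_dominated_convergence[where w = "\<lambda>p. \<bar>fst p * dx \<psi> p\<bar> * B"])
      show "integrable lborel (\<lambda>p::real \<times> real. \<bar>fst p * dx \<psi> p\<bar> * B)"
        by (rule integrable_bounded_support, intro continuous_intros cx,
          rule bounded_supportI[of R]) (simp add: R')
      show "(\<lambda>p. fst p * dx \<psi> p * dy w p) \<in> borel_measurable lborel"
        using continuous_on_mult[OF cf C1_continuous_dy[OF w]]
        by (auto intro: borel_measurable_continuous_onI)
      show "(\<lambda>p. fst p * dx \<psi> p * D' n p) \<in> borel_measurable lborel" for n
        using continuous_on_mult[OF cf cD']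
        by (auto intro: borel_measurable_continuous_onI)
      have "(\<lambda>n. D' n p) \<longlonglongrightarrow> dy w p" for p
      proof -
        have "(\<lambda>n. (w (p + (- h n) *\<^sub>R e) - w p) / (- h n)) \<longlonglongrightarrow> fst e * dx w p + snd e * dy w p"
          by (rule difference_quotient_tendsto[OF w])
             (use tendsto_minus[OF lim] h(1) in \<open>auto simp: less_imp_neq[THEN not_sym]\<close>)
        moreover have "(w (p + (- h n) *\<^sub>R e) - w p) / (- h n) = D' n p" for n
          using h(1)[of n] by (simp add: D'_def field_simps)
        ultimately show ?thesis by (simp add: e_def)
      qed
      then show "AE p in lborel. (\<lambda>n. fst p * dx \<psi> p * D' n p) \<longlonglongrightarrow> fst p * dx \<psi> p * dy w p"
        by (intro always_eventually allI tendsto_intros)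
      show "AE p in lborel. norm (fst p * dx \<psi> p * D' n p) \<le> \<bar>fst p * dx \<psi> p\<bar> * B" for n
      proof (intro always_eventually allI)
        fix p :: "real \<times> real"
        show "norm (fst p * dx \<psi> p * D' n p) \<le> \<bar>fst p * dx \<psi> p\<bar> * B"
        proof (cases "norm p \<le> R")
          case True
          have "\<bar>w p - w (p + (- h n) *\<^sub>R e)\<bar> \<le> B * h n"
            using B(2)[of p "p + (- h n) *\<^sub>R e"] True nt(3)[of p n] h(2)[of n] ne[of n] by simp
          then have "\<bar>D' n p\<bar> \<le> B"
            using h(1)[of n] by (simp add: D'_def abs_divide pos_divide_le_eq)
          then show ?thesis by (simp add: abs_mult mult_left_mono)
        qed (simp add: R')
      qed
    qed
  qed
  ultimately have main: "(LINT p|lborel. k p * dy \<psi> p) = (LINT p|lborel. fst p * dx \<psi> p * dy w p)"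
    unfolding eq by (rule LIMSEQ_unique)
  have bs: "bounded {p. dy \<psi> p \<noteq> 0}" "bounded {p. dx \<psi> p \<noteq> 0}"
    using bounded_support_dx bounded_support_dy \<psi>(2) by auto
  \<comment> \<open>The summand \<open>w p\<close> of \<open>k p\<close> is the surplus in
    \<open>main\<close>; an ordinary integration by parts turns it into the right-hand side of the
    claim.\<close>
  have "(LINT p|lborel. dy (\<lambda>p. w p * \<psi> p) p) = 0"
    by (rule integral_dx_dy_eq_0(2)[OF C1_mult(1)[OF w \<psi>(1)] bounded_support_mult(2)[OF \<psi>(2)]])
  moreover have i: "integrable lborel (\<lambda>p. dy w p * \<psi> p)" "integrable lborel (\<lambda>p. w p * dy \<psi> p)"
    "integrable lborel (\<lambda>p. (fst p * dx w p) * dy \<psi> p)" "integrable lborel (\<lambda>p. fst p * dy w p * dx \<psi> p)"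
    by (intro integrable_bounded_support bounded_support_mult(2) \<psi> bs continuous_intros
        C1_continuous C1_continuous_dx C1_continuous_dy w)+
  ultimately have ibp: "(LINT p|lborel. dy w p * \<psi> p) = - (LINT p|lborel. w p * dy \<psi> p)"
    by (simp add: C1_mult[OF w \<psi>(1)])
  have "(LINT p|lborel. fst p * (dx w p * dy \<psi> p - dy w p * dx \<psi> p))
      = (LINT p|lborel. (fst p * dx w p) * dy \<psi> p - fst p * dy w p * dx \<psi> p)"
    by (simp add: algebra_simps)
  also have "\<dots> = (LINT p|lborel. (fst p * dx w p) * dy \<psi> p) - (LINT p|lborel. fst p * dy w p * dx \<psi> p)"
    using i by simp
  also have "(LINT p|lborel. fst p * dy w p * dx \<psi> p) = (LINT p|lborel. k p * dy \<psi> p)"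
    unfolding main by (simp add: mult_ac)
  also have "\<dots> = (LINT p|lborel. w p * dy \<psi> p) + (LINT p|lborel. (fst p * dx w p) * dy \<psi> p)"
    unfolding k_def distrib_right using i by simp
  finally show ?thesis using ibp by simp
qed

section \<open>The linearized equation\<close>

lemma grad_inner: "grad f p \<bullet> grad g p = dx f p * dx g p + (fst p)\<^sup>2 * dy f p * dy g p"
  by (simp add: grad_def inner_vec_def sum_2 X_def Y_def power2_eq_square algebra_simps)

lemma grad_norm: "(norm (grad f p))\<^sup>2 = grad f p \<bullet> grad f p"
  by (simp add: power2_norm_eq_inner)

lemma Y_eq: "Y f = (\<lambda>p. fst p * dy f p)"
  by (simp add: Y_def fun_eq_iff)

lemma C1_Y:
  assumes "C1 (dy v)"
  shows "C1 (Y v)" "dx (Y v) = (\<lambda>p. dy v p + fst p * dx (dy v) p)"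
    "dy (Y v) = (\<lambda>p. fst p * dy (dy v) p)"
  unfolding Y_eq using C1_mult[OF C1_fst(1) assms] by (simp_all add: C1_fst)

lemmas C1_conts = C1_continuous C1_continuous_dx C1_continuous_dy

text \<open>With \<open>L = XX + YY\<close>, formally \<open>X L v = L X v + 2 Z Y v\<close> and
  \<open>Y L v = L Y v - 2 Z X v\<close>. Third derivatives of \<open>v\<close> need not exist, so
  each left-hand integrand is written as its source term plus pieces of zero integral.\<close>

lemma linearized_equations:
  fixes v F \<psi> :: "real \<times> real \<Rightarrow> real"
  assumes v: "C1 v" "C1 (dx v)" "C1 (dy v)" and F: "C1 F"
    and eq: "\<And>p. F p = dx (dx v) p + (fst p)\<^sup>2 * dy (dy v) p"
    and \<psi>: "C1 \<psi>" "bounded {p. \<psi> p \<noteq> 0}"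
  shows "(LINT p|lborel. grad (X v) p \<bullet> grad \<psi> p + X F p * \<psi> p) = (LINT p|lborel. 2 * Z (Y v) p * \<psi> p)"
    "(LINT p|lborel. grad (Y v) p \<bullet> grad \<psi> p + Y F p * \<psi> p) = (LINT p|lborel. - 2 * Z (X v) p * \<psi> p)"
proof -
  note comm = dx_dy_commute[OF v]
  note CY = C1_Y[OF v(3)]
  \<comment> \<open>A Jacobian, corrected by the lower-order term that the variable coefficient
    \<open>fst p\<close> creates, so that its integral vanishes by
    \<open>integral_jacobian\<close>.\<close>
  define J where "J w p = fst p * (dx w p * dy \<psi> p - dy w p * dx \<psi> p) - dy w p * \<psi> p" for w p
  have bs: "bounded {p. dy \<psi> p \<noteq> 0}" "bounded {p. dx \<psi> p \<noteq> 0}"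
    using bounded_support_dx bounded_support_dy \<psi>(2) by auto
  have iJ: "integrable lborel (J w)" "(LINT p|lborel. J w p) = 0" if w: "C1 w" for w
  proof -
    have "integrable lborel (\<lambda>p. fst p * dx w p * dy \<psi> p)" "integrable lborel (\<lambda>p. fst p * dy w p * dx \<psi> p)"
      by (intro integrable_bounded_support bounded_support_mult(2) bs continuous_intros C1_conts \<psi> w)+
    then have i: "integrable lborel (\<lambda>p. fst p * (dx w p * dy \<psi> p - dy w p * dx \<psi> p))"
      by (simp add: right_diff_distrib mult.assoc)
    have i': "integrable lborel (\<lambda>p. dy w p * \<psi> p)"
      by (intro integrable_bounded_support bounded_support_mult(2) continuous_intros C1_conts \<psi> w)
    show "integrable lborel (J w)" unfolding J_def using i i' by simp
    show "(LINT p|lborel. J w p) = 0"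
      unfolding J_def using i i' integral_jacobian[OF w \<psi>] by simp
  qed
  have ix: "integrable lborel (dx (\<lambda>p. w p * \<psi> p))" "(LINT p|lborel. dx (\<lambda>p. w p * \<psi> p) p) = 0"
    and iy: "integrable lborel (dy (\<lambda>p. w p * \<psi> p))" "(LINT p|lborel. dy (\<lambda>p. w p * \<psi> p) p) = 0"
    if w: "C1 w" for w
  proof -
    have c: "C1 (\<lambda>p. w p * \<psi> p)" and b: "bounded {p. w p * \<psi> p \<noteq> 0}"
      by (rule C1_mult(1)[OF w \<psi>(1)]) (rule bounded_support_mult(2)[OF \<psi>(2)])
    show "integrable lborel (dx (\<lambda>p. w p * \<psi> p))" "integrable lborel (dy (\<lambda>p. w p * \<psi> p))"
      by (intro integrable_bounded_support C1_conts c bounded_support_dx bounded_support_dy b)+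
    show "(LINT p|lborel. dx (\<lambda>p. w p * \<psi> p) p) = 0" "(LINT p|lborel. dy (\<lambda>p. w p * \<psi> p) p) = 0"
      by (rule integral_dx_dy_eq_0[OF c b])+
  qed
  have CF: "C1 (\<lambda>p. fst p * F p)" by (rule C1_mult(1)[OF C1_fst(1) F])
  have iZ: "integrable lborel (\<lambda>p. 2 * Z (Y v) p * \<psi> p)" "integrable lborel (\<lambda>p. - 2 * Z (X v) p * \<psi> p)"
    unfolding Z_def X_def
    by (intro integrable_bounded_support bounded_support_mult(2) continuous_intros C1_conts \<psi> v CY)+
  \<comment> \<open>The x-derivative of \<open>F p * \<psi> p\<close> contains the unwanted
    \<open>x^2 v_yy \<psi>_x\<close>, which \<open>J (Y v)\<close> exchanges for
    \<open>x^2 v_xy \<psi>_y\<close>; the y-derivative removes the leftover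
    \<open>x v_y \<psi>_y\<close>.\<close>
  have "grad (X v) p \<bullet> grad \<psi> p + X F p * \<psi> p
      = dx (\<lambda>p. F p * \<psi> p) p + J (Y v) p - dy (\<lambda>p. Y v p * \<psi> p) p + 2 * Z (Y v) p * \<psi> p" for p
    unfolding grad_inner X_def Z_def J_def C1_mult(2)[OF F \<psi>(1)] C1_mult(3)[OF CY(1) \<psi>(1)]
    by (simp add: CY eq comm Y_def) (simp add: algebra_simps power2_eq_square)
  then show "(LINT p|lborel. grad (X v) p \<bullet> grad \<psi> p + X F p * \<psi> p) = (LINT p|lborel. 2 * Z (Y v) p * \<psi> p)"
    using iJ[OF CY(1)] ix[OF F] iy[OF CY(1)] iZ by simp
  \<comment> \<open>Here \<open>J (X v)\<close> exchanges \<open>x v_xx \<psi>_y\<close> for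
    \<open>x v_xy \<psi>_x\<close>, and the x-derivative supplies the term
    \<open>v_y \<psi>_x\<close> coming from \<open>X (Y v)\<close>.\<close>
  have "grad (Y v) p \<bullet> grad \<psi> p + Y F p * \<psi> p
      = dy (\<lambda>p. fst p * F p * \<psi> p) p - J (X v) p + dx (\<lambda>p. dy v p * \<psi> p) p + - 2 * Z (X v) p * \<psi> p" for p
    unfolding grad_inner X_def Z_def J_def C1_mult(3)[OF CF \<psi>(1)] C1_mult(2)[OF v(3) \<psi>(1)]
      C1_mult(3)[OF C1_fst(1) F] C1_fst
    by (simp add: CY eq comm Y_def) (simp add: algebra_simps power2_eq_square)
  then show "(LINT p|lborel. grad (Y v) p \<bullet> grad \<psi> p + Y F p * \<psi> p) = (LINT p|lborel. - 2 * Z (X v) p * \<psi> p)"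
    using iJ[OF v(2)] ix[OF v(3)] iy[OF CF] iZ by (simp add: X_def)
qed

text \<open>A null set contains no nonempty open set, so vanishing almost everywhere improves to
  vanishing at every point.\<close>

lemma integral_nonneg_continuous_eq_0:
  fixes f :: "real \<times> real \<Rightarrow> real"
  assumes "continuous_on UNIV f" "bounded {p. f p \<noteq> 0}" "\<And>p. f p \<ge> 0" "(LINT p|lborel. f p) = 0"
  shows "f p = 0"
proof (rule ccontr)
  assume "f p \<noteq> 0"
  have "AE p in lborel. f p = 0"
    using integral_nonneg_eq_0_iff_AE[OF integrable_bounded_support[OF assms(1,2)]] assms(3,4) by simp
  then have "AE p in lebesgue. f p = 0" by (rule AE_completion)
  moreover have "open {p. f p \<noteq> 0}"
    by (intro open_Collect_neq assms(1) continuous_intros)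
  ultimately have "negligible {p. f p \<noteq> 0}"
    by (auto simp: negligible_iff_null_sets completion.AE_iff_null_sets lebesgue_openin)
  moreover have "{p. f p \<noteq> 0} \<noteq> {}" using \<open>f p \<noteq> 0\<close> by blast
  ultimately show False using open_not_negligible[OF \<open>open {p. f p \<noteq> 0}\<close>] by blast
qed

text \<open>Squaring makes the positive part C1, which is the regularity of the test functions, and
  keeps it zero on a half-line; bumps and cutoffs arise from it by composition.\<close>

definition sqpos :: "real \<Rightarrow> real" where
  "sqpos z = (max 0 z)\<^sup>2"

lemma has_field_derivative_sqpos: "(sqpos has_field_derivative 2 * max 0 z) (at z)"
proof -
  consider "z < 0" | "z > 0" | "z = 0" by linarith
  then show ?thesis
  proof cases
    case 1
    have "((\<lambda>z. 0) has_field_derivative 2 * max 0 z) (at z)" using 1 by auto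
    then show ?thesis
      by (rule has_field_derivative_transform_within_open[of _ _ _ "{..<0}"])
         (use 1 in \<open>auto simp: sqpos_def\<close>)
  next
    case 2
    have "((\<lambda>z. z\<^sup>2) has_field_derivative 2 * max 0 z) (at z)"
      using 2 by (auto intro!: derivative_eq_intros)
    then show ?thesis
      by (rule has_field_derivative_transform_within_open[of _ _ _ "{0<..}"])
         (use 2 in \<open>auto simp: sqpos_def\<close>)
  next
    case 3
    have "(\<lambda>h::real. \<bar>h\<bar>) \<midarrow>0\<rightarrow> 0" using tendsto_rabs_zero[OF tendsto_ident_at] by simp
    then have "(\<lambda>h. sqpos h / h) \<midarrow>0\<rightarrow> 0"
      by (rule Lim_null_comparison[rotated]) (auto simp: sqpos_def max_def power2_eq_square)
    then show ?thesis using 3 by (simp add: DERIV_def sqpos_def)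
  qed
qed

section \<open>Approximate null vectors of a nonnegative form\<close>

text \<open>Integrand of the polarized form \<open>Q\<close>; the theorem takes the coupling
  coefficients at \<open>u p\<close> for \<open>M\<close>.\<close>

definition energy :: "('m::finite \<Rightarrow> 'm \<Rightarrow> real \<times> real \<Rightarrow> real) \<Rightarrow> ('m \<Rightarrow> real \<times> real \<Rightarrow> real)
    \<Rightarrow> ('m \<Rightarrow> real \<times> real \<Rightarrow> real) \<Rightarrow> real \<times> real \<Rightarrow> real" where
  "energy M a b p = (\<Sum>i\<in>UNIV. grad (a i) p \<bullet> grad (b i) p) + (\<Sum>i\<in>UNIV. \<Sum>j\<in>UNIV. M i j p * a i p * b j p)"

lemma C1_compact_support_iff: "C1_compact_support f \<longleftrightarrow> C1 f \<and> bounded {p. f p \<noteq> 0}"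
  by (simp add: C1_compact_support_def)

lemma bounded_support_sum:
  fixes f :: "'i \<Rightarrow> real \<times> real \<Rightarrow> real"
  assumes "finite I" "\<And>i. i \<in> I \<Longrightarrow> bounded {p. f i p \<noteq> 0}"
  shows "bounded {p. (\<Sum>i\<in>I. f i p) \<noteq> 0}"
proof (rule bounded_subset)
  show "bounded (\<Union>i\<in>I. {p. f i p \<noteq> 0})" using assms by auto
  show "{p. (\<Sum>i\<in>I. f i p) \<noteq> 0} \<subseteq> (\<Union>i\<in>I. {p. f i p \<noteq> 0})"
    by (auto dest: sum.not_neutral_contains_not_neutral)
qed

lemma bounded_support_add:
  fixes f g :: "real \<times> real \<Rightarrow> real"
  assumes "bounded {p. f p \<noteq> 0}" "bounded {p. g p \<noteq> 0}"
  shows "bounded {p. f p + g p \<noteq> 0}"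
  by (rule bounded_subset[OF bounded_Un[THEN iffD2, OF conjI[OF assms]]]) auto

lemma integrable_energy:
  assumes "\<And>i j. continuous_on UNIV (M i j)" "\<And>i. C1 (a i)" "\<And>i. C1_compact_support (b i)"
  shows "integrable lborel (energy M a b)"
proof -
  have b: "C1 (b i)" "bounded {p. b i p \<noteq> 0}" for i
    using assms(3) unfolding C1_compact_support_iff by auto
  have "continuous_on UNIV (energy M a b)"
    unfolding energy_def grad_inner by (intro continuous_intros C1_conts assms b)
  moreover have "bounded {p. energy M a b p \<noteq> 0}"
    unfolding energy_def grad_inner
    by (intro bounded_support_add bounded_support_sum finite bounded_support_mult(2)
        bounded_support_dx bounded_support_dy b)
  ultimately show ?thesis by (rule integrable_bounded_support)
qed

text \<open>Symmetry of \<open>M\<close> merges the two mixed zero-order sums into one cross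
  term.\<close>

lemma energy_add_scale:
  assumes sym: "\<And>i j. M i j p = M j i p" and a: "\<And>i. C1 (a i)" and b: "\<And>i. C1 (b i)"
  shows "energy M (\<lambda>i p. a i p + t * b i p) (\<lambda>i p. a i p + t * b i p) p
    = energy M a a p + 2 * t * energy M a b p + t\<^sup>2 * energy M b b p"
proof -
  have tb: "C1 (\<lambda>p. t * b i p)" for i by (rule C1_mult(1)[OF C1_const(1) b])
  have g: "grad (\<lambda>p. a i p + t * b i p) p = grad (a i) p + t *\<^sub>R grad (b i) p" for i
    unfolding grad_def X_def Y_def C1_add(2,3)[OF a tb] C1_mult(2,3)[OF C1_const(1) b] C1_const(2,3)
    by (simp add: vec_eq_iff forall_2 algebra_simps)
  have 1: "(\<Sum>i\<in>UNIV. (grad (a i) p + t *\<^sub>R grad (b i) p) \<bullet> (grad (a i) p + t *\<^sub>R grad (b i) p))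
    = (\<Sum>i\<in>UNIV. grad (a i) p \<bullet> grad (a i) p) + 2 * t * (\<Sum>i\<in>UNIV. grad (a i) p \<bullet> grad (b i) p)
      + t\<^sup>2 * (\<Sum>i\<in>UNIV. grad (b i) p \<bullet> grad (b i) p)"
    unfolding sum_distrib_left sum.distrib[symmetric]
    by (intro sum.cong refl) (simp add: inner_simps inner_commute power2_eq_square algebra_simps)
  have "(\<Sum>i\<in>UNIV. \<Sum>j\<in>UNIV. M i j p * b i p * a j p) = (\<Sum>i\<in>UNIV. \<Sum>j\<in>UNIV. M i j p * a i p * b j p)"
    by (subst sum.swap) (simp add: sym mult_ac)
  moreover have "(\<Sum>i\<in>UNIV. \<Sum>j\<in>UNIV. M i j p * (a i p + t * b i p) * (a j p + t * b j p))
    = (\<Sum>i\<in>UNIV. \<Sum>j\<in>UNIV. M i j p * a i p * a j p)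
      + (t * (\<Sum>i\<in>UNIV. \<Sum>j\<in>UNIV. M i j p * a i p * b j p) + t * (\<Sum>i\<in>UNIV. \<Sum>j\<in>UNIV. M i j p * b i p * a j p))
      + t\<^sup>2 * (\<Sum>i\<in>UNIV. \<Sum>j\<in>UNIV. M i j p * b i p * b j p)"
    unfolding sum_distrib_left sum.distrib[symmetric]
    by (intro sum.cong refl) (simp add: power2_eq_square algebra_simps)
  ultimately show ?thesis unfolding energy_def g 1 by (simp add: algebra_simps)
qed

text \<open>\<open>|grad (\<phi> a)|^2\<close> and the product of \<open>grad a\<close> with
  \<open>grad (\<phi>^2 a)\<close> differ by exactly \<open>a^2 |grad \<phi>|^2\<close>, and the
  zero-order terms agree. The energy of a truncated field thus becomes a tested weak equation plus
  an error carried by the gradient of the cutoff.\<close>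

lemma energy_localize:
  assumes a: "\<And>i. C1 (a i)" and \<phi>: "C1 \<phi>"
  shows "energy M (\<lambda>i p. \<phi> p * a i p) (\<lambda>i p. \<phi> p * a i p) p
    = (\<Sum>i\<in>UNIV. (a i p)\<^sup>2) * (norm (grad \<phi> p))\<^sup>2 + energy M a (\<lambda>i p. \<phi> p * (\<phi> p * a i p)) p"
proof -
  have pa: "C1 (\<lambda>p. \<phi> p * a i p)" for i by (rule C1_mult(1)[OF \<phi> a])
  have g: "grad (\<lambda>p. \<phi> p * a i p) p \<bullet> grad (\<lambda>p. \<phi> p * a i p) p
      = (a i p)\<^sup>2 * (norm (grad \<phi> p))\<^sup>2 + grad (a i) p \<bullet> grad (\<lambda>p. \<phi> p * (\<phi> p * a i p)) p" for i
    unfolding grad_norm grad_inner C1_mult(2,3)[OF \<phi> pa] C1_mult(2,3)[OF \<phi> a]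
    by (simp add: power2_eq_square algebra_simps)
  show ?thesis
    unfolding energy_def g sum_distrib_right sum.distrib by (simp add: mult_ac)
qed

text \<open>Perturbing \<open>\<phi> a\<close> to \<open>\<phi> a + t \<psi>\<close>, where \<open>\<phi> = 1\<close> on the support of \<open>\<psi>\<close>, shows that \<open>a\<close> is orthogonal to \<open>\<psi>\<close>.\<close>

lemma null_vector_source_eq_0:
  fixes M :: "'m::finite \<Rightarrow> 'm \<Rightarrow> real \<times> real \<Rightarrow> real"
  assumes M: "\<And>i j. continuous_on UNIV (M i j)" "\<And>i j p. M i j p = M j i p"
    and nonneg: "\<And>\<zeta>. (\<And>i. C1_compact_support (\<zeta> i)) \<Longrightarrow> 0 \<le> (LINT p|lborel. energy M \<zeta> \<zeta> p)"
    and a: "\<And>i. C1 (a i)" and s: "\<And>i. continuous_on UNIV (s i)"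
    and weak: "\<And>\<psi>. (\<And>i. C1_compact_support (\<psi> i)) \<Longrightarrow>
      (LINT p|lborel. energy M a \<psi> p) = (LINT p|lborel. (\<Sum>i\<in>UNIV. s i p * \<psi> i p))"
    and cutoff: "\<And>K \<epsilon>. \<epsilon> > 0 \<Longrightarrow> \<exists>\<phi>. C1_compact_support \<phi> \<and>
      (\<forall>p. norm p \<le> K \<longrightarrow> \<phi> p = 1 \<and> dx \<phi> p = 0 \<and> dy \<phi> p = 0) \<and>
      (LINT p|lborel. energy M (\<lambda>i p. \<phi> p * a i p) (\<lambda>i p. \<phi> p * a i p) p) \<le> \<epsilon>"
  shows "s k p0 = 0"
proof -
  have orth: "(LINT p|lborel. energy M a \<psi> p) = 0" if \<psi>: "\<And>i. C1_compact_support (\<psi> i)" for \<psi>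
  proof -
    have \<psi>': "C1 (\<psi> i)" "bounded {p. \<psi> i p \<noteq> 0}" for i
      using \<psi> unfolding C1_compact_support_iff by auto
    define S where "S = (LINT p|lborel. energy M a \<psi> p)"
    define q where "q = (LINT p|lborel. energy M \<psi> \<psi> p)"
    have "q \<ge> 0" unfolding q_def by (rule nonneg[OF \<psi>])
    have "bounded (\<Union>i. {p. \<psi> i p \<noteq> 0})" using \<psi>' by auto
    then obtain K where K': "\<And>p. p \<in> (\<Union>i. {p. \<psi> i p \<noteq> 0}) \<Longrightarrow> norm p \<le> K"
      unfolding bounded_iff by blast
    then have K: "\<psi> i p = 0" if "norm p > K" for i p
      using that by (fastforce simp: not_le[symmetric])
    have K1: "dx (\<psi> i) p = 0" "dy (\<psi> i) p = 0" if "norm p > K" for i p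
      using dx_dy_eq_0_outside[of K "\<psi> i", OF K that] by auto
    \<comment> \<open>\<open>S\<close> and \<open>q\<close> do not depend on the cutoff, so its
      error \<open>\<epsilon>\<close> can tend to 0 while \<open>t\<close> stays fixed.\<close>
    have *: "0 \<le> 2 * t * S + t\<^sup>2 * q" for t
    proof (rule field_le_epsilon)
      fix \<epsilon> :: real assume "\<epsilon> > 0"
      then obtain \<phi> where \<phi>: "C1_compact_support \<phi>"
        and flat: "\<And>p. norm p \<le> K \<Longrightarrow> \<phi> p = 1 \<and> dx \<phi> p = 0 \<and> dy \<phi> p = 0"
        and small: "(LINT p|lborel. energy M (\<lambda>i p. \<phi> p * a i p) (\<lambda>i p. \<phi> p * a i p) p) \<le> \<epsilon>"
        using cutoff by meson
      have \<phi>': "C1 \<phi>" "bounded {p. \<phi> p \<noteq> 0}"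
        using \<phi> unfolding C1_compact_support_iff by auto
      let ?a = "\<lambda>i p. \<phi> p * a i p"
      have Ca: "C1 (?a i)" for i by (rule C1_mult(1)[OF \<phi>'(1) a])
      have Ca': "C1_compact_support (?a i)" for i
        unfolding C1_compact_support_iff using Ca bounded_support_mult(1)[OF \<phi>'(2)] by blast
      \<comment> \<open>Within radius \<open>K\<close> the cutoff agrees with 1 to first order;
        beyond it \<open>\<psi>\<close> and its derivatives vanish.\<close>
      have cross: "energy M ?a \<psi> = energy M a \<psi>"
      proof
        fix p
        show "energy M ?a \<psi> p = energy M a \<psi> p"
        proof (cases "norm p \<le> K")
          case True
          then show ?thesis
            using flat[OF True] by (simp add: energy_def grad_inner C1_mult(2,3)[OF \<phi>'(1) a])
        next
          case False
          then show ?thesis by (simp add: energy_def grad_inner K K1)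
        qed
      qed
      have "C1_compact_support (\<lambda>p. ?a i p + t * \<psi> i p)" for i
        unfolding C1_compact_support_iff
        by (intro conjI C1_add(1) C1_mult(1) C1_const \<phi>' \<psi>' a bounded_support_add
            bounded_support_mult(1)[OF \<phi>'(2)] bounded_support_mult(2)[OF \<psi>'(2)])
      then have "0 \<le> (LINT p|lborel. energy M (\<lambda>i p. ?a i p + t * \<psi> i p) (\<lambda>i p. ?a i p + t * \<psi> i p) p)"
        by (rule nonneg)
      also have "\<dots> = (LINT p|lborel. energy M ?a ?a p + 2 * t * energy M a \<psi> p + t\<^sup>2 * energy M \<psi> \<psi> p)"
      proof -
        have "energy M (\<lambda>i p. ?a i p + t * \<psi> i p) (\<lambda>i p. ?a i p + t * \<psi> i p) p
            = energy M ?a ?a p + 2 * t * energy M ?a \<psi> p + t\<^sup>2 * energy M \<psi> \<psi> p" for p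
          by (rule energy_add_scale[OF M(2) Ca \<psi>'(1)])
        then show ?thesis unfolding cross by presburger
      qed
      also have "\<dots> = (LINT p|lborel. energy M ?a ?a p) + 2 * t * S + t\<^sup>2 * q"
        unfolding S_def q_def
        using integrable_energy[of M ?a ?a, OF M(1) Ca Ca'] integrable_energy[of M a \<psi>, OF M(1) a \<psi>]
          integrable_energy[of M \<psi> \<psi>, OF M(1) \<psi>'(1) \<psi>] by simp
      finally show "0 \<le> 2 * t * S + t\<^sup>2 * q + \<epsilon>" using small by simp
    qed
    \<comment> \<open>The summand 1 covers \<open>q = 0\<close>. At \<open>t = - S * x\<close> the
      quadratic is negative unless \<open>S = 0\<close>.\<close>
    define x where "x = 1 / (q + 1)"
    have x: "x > 0" "x * q \<le> 1" using \<open>q \<ge> 0\<close> by (auto simp: x_def field_simps)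
    have "0 \<le> 2 * (- S * x) * S + (- S * x)\<^sup>2 * q" by (rule *)
    also have "\<dots> = S\<^sup>2 * (x * (x * q - 2))" by (simp add: power2_eq_square algebra_simps)
    finally have "0 \<le> S\<^sup>2 * (x * (x * q - 2))" .
    moreover have "x * (x * q - 2) < 0" using x by (intro mult_pos_neg) auto
    ultimately have "S = 0" using mult_pos_neg[of "S\<^sup>2" "x * (x * q - 2)"] by force
    then show ?thesis unfolding S_def .
  qed
  show ?thesis
  proof (rule ccontr)
    assume ne: "s k p0 \<noteq> 0"
    \<comment> \<open>Multiplying by the value at \<open>p0\<close> treats both signs of the source
      at once.\<close>
    have "open {p. s k p * s k p0 > 0}"
      by (intro open_Collect_less continuous_intros s)
    moreover have "s k p0 * s k p0 > 0" using ne not_real_square_gt_zero by blast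
    ultimately obtain r where "r > 0" "ball p0 r \<subseteq> {p. s k p * s k p0 > 0}"
      using open_contains_ball[of "{p. s k p * s k p0 > 0}"] by blast
    then have r: "r > 0" "\<And>p. dist p0 p < r \<Longrightarrow> s k p * s k p0 > 0"
      using mem_ball by blast+
    \<comment> \<open>The squared positive part of \<open>r^2 - |p - p0|^2\<close>, a C1 bump on the
      ball of radius \<open>r\<close>; differences are spelled with sums and products to fit the C1
      rules.\<close>
    define \<beta> where "\<beta> p = sqpos (r\<^sup>2 + (- 1) * ((fst p + - fst p0) * (fst p + - fst p0)
      + (snd p + - snd p0) * (snd p + - snd p0)))" for p
    have x: "C1 (\<lambda>p::real \<times> real. fst p + - fst p0)" and y: "C1 (\<lambda>p::real \<times> real. snd p + - snd p0)"
      by (rule C1_add(1)[OF C1_fst(1) C1_const(1)]) (rule C1_add(1)[OF C1_snd(1) C1_const(1)])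
    have C\<beta>: "C1 \<beta>"
      unfolding \<beta>_def
      by (rule C1_comp(1)[OF C1_add(1)[OF C1_const(1) C1_mult(1)[OF C1_const(1)
          C1_add(1)[OF C1_mult(1)[OF x x] C1_mult(1)[OF y y]]]] has_field_derivative_sqpos])
         (intro continuous_intros)
    have \<beta>0: "\<beta> p = 0" if "dist p0 p \<ge> r" for p
    proof -
      have "r\<^sup>2 \<le> (dist p0 p)\<^sup>2" using that r(1) by (intro power_mono) auto
      then show ?thesis
        by (simp add: \<beta>_def sqpos_def dist_prod_def dist_real_def power2_commute power2_eq_square[symmetric])
    qed
    have bounded\<beta>: "bounded {p. \<beta> p \<noteq> 0}"
      by (rule bounded_subset[OF bounded_ball[of p0 r]]) (use \<beta>0 in \<open>force simp: not_less\<close>)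
    \<comment> \<open>Only component \<open>k\<close> is tested, with the factor that makes the
      integrand nonnegative.\<close>
    define \<psi> where "\<psi> i p = (if i = k then s k p0 else 0) * \<beta> p" for i p
    have c\<psi>: "C1_compact_support (\<psi> i)" for i
      unfolding C1_compact_support_iff \<psi>_def
      by (intro conjI C1_mult(1) C1_const C\<beta> bounded_support_mult(2) bounded\<beta>)
    have "(LINT p|lborel. (\<Sum>i\<in>UNIV. s i p * \<psi> i p)) = 0"
      using weak[of \<psi>, OF c\<psi>] orth[of \<psi>, OF c\<psi>] by (rule trans[OF sym])
    moreover have "(\<Sum>i\<in>UNIV. s i p * \<psi> i p) = s k p * s k p0 * \<beta> p" for p
    proof -
      have "(\<Sum>i\<in>UNIV. s i p * \<psi> i p) = (\<Sum>i\<in>UNIV. if i = k then s k p * s k p0 * \<beta> p else 0)"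
        by (intro sum.cong) (auto simp: \<psi>_def)
      then show ?thesis by simp
    qed
    ultimately have int0: "(LINT p|lborel. s k p * s k p0 * \<beta> p) = 0" by simp
    have cont: "continuous_on UNIV (\<lambda>p. s k p * s k p0 * \<beta> p)"
      by (intro continuous_intros s C1_continuous C\<beta>)
    have "s k p * s k p0 * \<beta> p \<ge> 0" for p
      using r(2)[of p] \<beta>0[of p] by (cases "dist p0 p < r") (auto simp: \<beta>_def sqpos_def)
    then have "s k p0 * s k p0 * \<beta> p0 = 0"
      by (rule integral_nonneg_continuous_eq_0[OF cont bounded_support_mult(2)[OF bounded\<beta>] _ int0])
    moreover have "\<beta> p0 > 0" using r(1) by (simp add: \<beta>_def sqpos_def)
    ultimately show False using ne by simp
  qed
qed

section \<open>Logarithmic cutoff functions\<close>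

text \<open>Fourth power of the homogeneous Grushin gauge; as a polynomial it is C1 at the origin
  too, and the product form fits \<open>C1_mult\<close>.\<close>

definition gauge4 :: "real \<times> real \<Rightarrow> real" where
  "gauge4 p = (fst p * fst p) * (fst p * fst p) + snd p * snd p"

lemma C1_gauge4: "C1 gauge4" "dx gauge4 p = 4 * fst p ^ 3" "dy gauge4 p = 2 * snd p"
proof -
  note xx = C1_mult[OF C1_fst(1) C1_fst(1)]
  note xxxx = C1_mult[OF xx(1) xx(1)]
  note yy = C1_mult[OF C1_snd(1) C1_snd(1)]
  have "gauge4 = (\<lambda>p. (fst p * fst p) * (fst p * fst p) + snd p * snd p)"
    by (simp add: gauge4_def fun_eq_iff)
  note * = C1_add[OF xxxx(1) yy(1), folded this]
  show "C1 gauge4" by (rule *(1))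
  show "dx gauge4 p = 4 * fst p ^ 3"
    unfolding *(2) xxxx xx yy C1_fst C1_snd by (simp add: power3_eq_cube)
  show "dy gauge4 p = 2 * snd p"
    unfolding *(3) xxxx xx yy C1_fst C1_snd by simp
qed

text \<open>The lower bound on \<open>gauge4\<close> makes its sublevel sets bounded; the upper
  bound places Euclidean balls inside them, where the cutoffs have to equal 1.\<close>

lemma gauge4_bounds: "0 \<le> gauge4 p" "(norm p)\<^sup>2 \<le> 1 + gauge4 p" "gauge4 p \<le> norm p ^ 4 + (norm p)\<^sup>2"
proof -
  have n: "(norm p)\<^sup>2 = (fst p)\<^sup>2 + (snd p)\<^sup>2" by (simp add: norm_prod_def)
  have g: "gauge4 p = ((fst p)\<^sup>2)\<^sup>2 + (snd p)\<^sup>2" by (simp add: gauge4_def power2_eq_square)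
  show "0 \<le> gauge4 p" by (simp add: g)
  have "0 \<le> ((fst p)\<^sup>2 - 1)\<^sup>2" by (rule zero_le_power2)
  then have "(fst p)\<^sup>2 \<le> 1 + ((fst p)\<^sup>2)\<^sup>2"
    using zero_le_power2[of "fst p"] unfolding power2_diff power_one mult_1_right by linarith
  then show "(norm p)\<^sup>2 \<le> 1 + gauge4 p" by (simp add: n g)
  have "((fst p)\<^sup>2)\<^sup>2 \<le> ((norm p)\<^sup>2)\<^sup>2" by (rule power_mono) (auto simp: n)
  moreover have "norm p ^ 4 = ((norm p)\<^sup>2)\<^sup>2" by (simp flip: power_mult)
  moreover have "(snd p)\<^sup>2 \<le> (norm p)\<^sup>2" by (simp add: n)
  ultimately show "gauge4 p \<le> norm p ^ 4 + (norm p)\<^sup>2" unfolding g by linarith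
qed

text \<open>\<open>chi k\<close> varies only where \<open>16 ^ k < x\<^sup>4 + y\<^sup>2 < 2 * 16 ^ k\<close>. These regions are disjoint for different \<open>k\<close>,
  so the gradient of an average of \<open>N\<close> of the \<open>chi k\<close> gains a factor \<open>1 / N\<^sup>2\<close> against only \<open>N\<close> contributions.\<close>

definition chi :: "nat \<Rightarrow> real \<times> real \<Rightarrow> real" where
  "chi k p = sqpos (1 + (- 1) * sqpos (gauge4 p * (1 / 16 ^ k) + (- 1)))"

text \<open>The chain-rule factor between the derivatives of \<open>chi k\<close> and those of
  \<open>gauge4\<close>; \<open>- 4\<close> collects a 2 from each \<open>sqpos\<close> and the
  inner sign.\<close>

definition chi_weight :: "nat \<Rightarrow> real \<times> real \<Rightarrow> real" where
  "chi_weight k p = - 4 * max 0 (1 - sqpos (gauge4 p / 16 ^ k - 1)) * max 0 (gauge4 p / 16 ^ k - 1) / 16 ^ k"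

lemma C1_chi: "C1 (chi k)" "dx (chi k) p = chi_weight k p * dx gauge4 p"
  "dy (chi k) p = chi_weight k p * dy gauge4 p"
proof -
  note m = C1_mult[OF C1_gauge4(1) C1_const(1)[of "1 / 16 ^ k"]]
  note t = C1_add[OF m(1) C1_const(1)[of "- 1"]]
  have c: "continuous_on UNIV (\<lambda>z. 2 * max 0 z :: real)" by (intro continuous_intros)
  note s = C1_comp[OF t(1) has_field_derivative_sqpos c]
  note ms = C1_mult[OF C1_const(1)[of "- 1"] s(1)]
  note r = C1_add[OF C1_const(1)[of 1] ms(1)]
  have "chi k = (\<lambda>p. sqpos (1 + (- 1) * sqpos (gauge4 p * (1 / 16 ^ k) + (- 1))))"
    by (simp add: chi_def fun_eq_iff)
  note * = C1_comp[OF r(1) has_field_derivative_sqpos c, folded this]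
  show "C1 (chi k)" by (rule *(1))
  show "dx (chi k) p = chi_weight k p * dx gauge4 p" "dy (chi k) p = chi_weight k p * dy gauge4 p"
    unfolding *(2,3) r ms s t m C1_const by (simp_all add: chi_weight_def)
qed

text \<open>With \<open>t = gauge4 p / 16 ^ k - 1\<close>, both positive parts in the weight are
  nonzero only for \<open>0 < t < 1\<close>, and there they are at most 1; the bound 16 is the
  square of \<open>- 4\<close>.\<close>

lemma chi_weight_nonzero:
  assumes "chi_weight k p \<noteq> 0"
  shows "16 ^ k < gauge4 p" "gauge4 p < 2 * 16 ^ k" "(chi_weight k p)\<^sup>2 \<le> 16 / (16 ^ k)\<^sup>2"
proof -
  define t where "t = gauge4 p / 16 ^ k - 1"
  have ne: "max 0 (1 - sqpos t) \<noteq> 0" "max 0 t \<noteq> 0"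
    using assms by (auto simp: chi_weight_def t_def)
  then have t0: "t > 0" by (auto simp: max_def split: if_splits)
  with ne(1) have "t\<^sup>2 < 1" by (auto simp: sqpos_def max_def split: if_splits)
  then have t1: "t < 1" by (simp add: power2_less_1_iff abs_if split: if_splits)
  show "16 ^ k < gauge4 p" using t0 by (simp add: t_def field_simps)
  show "gauge4 p < 2 * 16 ^ k" using t1 by (simp add: t_def field_simps)
  define y where "y = max 0 (1 - sqpos t) * max 0 t"
  have "0 \<le> max 0 (1 - sqpos t)" "max 0 (1 - sqpos t) \<le> 1" "0 \<le> max 0 t" "max 0 t \<le> 1"
    using t0 t1 by (auto simp: sqpos_def)
  then have "0 \<le> y" "y \<le> 1" unfolding y_def by (auto intro: mult_le_one)
  then have "y\<^sup>2 \<le> 1" by (simp add: power_le_one)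
  moreover have "(chi_weight k p)\<^sup>2 = 16 * y\<^sup>2 / (16 ^ k)\<^sup>2"
    by (simp add: chi_weight_def t_def[symmetric] y_def power_mult_distrib power_divide)
  ultimately show "(chi_weight k p)\<^sup>2 \<le> 16 / (16 ^ k)\<^sup>2"
    by (simp add: divide_right_mono)
qed

lemma chi_eq_0: "gauge4 p \<ge> 2 * 16 ^ k \<Longrightarrow> chi k p = 0"
proof -
  assume "gauge4 p \<ge> 2 * 16 ^ k"
  then have "1 \<le> gauge4 p / 16 ^ k - 1" by (simp add: field_simps)
  then have "1 \<le> sqpos (gauge4 p / 16 ^ k - 1)" by (simp add: sqpos_def)
  then show ?thesis by (simp add: chi_def) (simp add: sqpos_def)
qed

lemma chi_eq_1: "gauge4 p \<le> 16 ^ k \<Longrightarrow> chi k p = 1"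
proof -
  assume "gauge4 p \<le> 16 ^ k"
  then have "gauge4 p / 16 ^ k - 1 \<le> 0" by (simp add: field_simps)
  then show ?thesis by (simp add: chi_def) (simp add: sqpos_def)
qed

text \<open>Consecutive scales differ by the factor 16, whereas one shell spans only a factor
  2.\<close>

lemma chi_weight_mult_eq_0:
  assumes "j < k"
  shows "chi_weight j p * chi_weight k p = 0"
proof (rule ccontr)
  assume "\<not> ?thesis"
  then have "gauge4 p < 2 * 16 ^ j" "16 ^ k < gauge4 p"
    using chi_weight_nonzero by auto
  moreover have "(16::real) ^ Suc j \<le> 16 ^ k"
    using assms by (intro power_increasing) auto
  moreover have "(0::real) < 16 ^ j" by simp
  ultimately show False by simp
qed

text \<open>Disjoint shells leave no cross terms, which is where averaging gains over the triangle
  inequality.\<close>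

lemma sum_chi_weight_squared:
  "(\<Sum>k\<in>{n..<n + N}. chi_weight k p)\<^sup>2 = (\<Sum>k\<in>{n..<n + N}. (chi_weight k p)\<^sup>2)"
proof (induction N)
  case (Suc N)
  have "(\<Sum>k\<in>{n..<n + N}. chi_weight k p) * chi_weight (n + N) p = 0"
    unfolding sum_distrib_right by (intro sum.neutral ballI chi_weight_mult_eq_0) simp
  then show ?case using Suc by (simp add: power2_sum)
qed simp

lemma grushin_ball_gauge4: "grushin_ball R = {p. gauge4 p < R ^ 4}"
  by (auto simp: grushin_ball_def gauge4_def power4_eq_xxxx power2_eq_square mult.assoc)

lemma set_integrable_grushin_ball:
  fixes f :: "real \<times> real \<Rightarrow> real"
  assumes "continuous_on UNIV f"
  shows "set_integrable lborel (grushin_ball R) f"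
proof (rule set_integrable_subset)
  define S where "S = cball (0 :: real \<times> real) (1 + R ^ 4)"
  show "set_integrable lborel S f"
    unfolding S_def set_integrable_def
    by (rule borel_integrable_compact[OF compact_cball continuous_on_subset[OF assms]]) auto
  have "open (grushin_ball R)"
    unfolding grushin_ball_gauge4 by (intro open_Collect_less continuous_intros C1_continuous C1_gauge4)
  then show "grushin_ball R \<in> sets lborel" by simp
  show "grushin_ball R \<subseteq> S"
  proof
    fix p assume "p \<in> grushin_ball R"
    then have "(norm p)\<^sup>2 \<le> 1 + R ^ 4"
      using gauge4_bounds(2)[of p] by (auto simp: grushin_ball_gauge4)
    also have "\<dots> \<le> (1 + R ^ 4)\<^sup>2" by (rule self_le_power) auto
    finally have "norm p \<le> 1 + R ^ 4" by (rule power2_le_imp_le) simp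
    then show "p \<in> S" by (simp add: S_def)
  qed
qed

text \<open>On the shell of \<open>chi k\<close> the squared weight is at most
  \<open>16 / (16 ^ k)^2\<close> and the squared gradient of \<open>gauge4\<close> at most
  \<open>32 * 16 ^ k * x^2\<close>, giving the factor \<open>512 / 16 ^ k\<close>. The growth bound
  with \<open>R ^ 4 = 16 * 16 ^ k\<close> makes the cost of each shell at most
  \<open>8192 * C\<close>, independently of \<open>k\<close>; averaging \<open>N\<close> shells
  divides the total by \<open>N^2\<close>.\<close>

lemma cutoff_exists:
  fixes f :: "real \<times> real \<Rightarrow> real"
  assumes f: "continuous_on UNIV f" "\<And>p. 0 \<le> f p"
    and growth: "\<And>R. R > 1 \<Longrightarrow> (LINT p:grushin_ball R|lborel. (fst p)\<^sup>2 * f p) \<le> C * R ^ 4"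
    and \<epsilon>: "\<epsilon> > 0"
  shows "\<exists>\<phi>. C1_compact_support \<phi> \<and> (\<forall>p. norm p \<le> K \<longrightarrow> \<phi> p = 1 \<and> dx \<phi> p = 0 \<and> dy \<phi> p = 0) \<and>
    (LINT p|lborel. f p * (norm (grad \<phi> p))\<^sup>2) \<le> \<epsilon>"
proof -
  \<comment> \<open>All scales from \<open>n\<close> on have the Euclidean ball of radius
    \<open>K\<close> in their plateau; absolute values allow for negative \<open>K\<close>.\<close>
  obtain n where n: "\<bar>K\<bar> ^ 4 + \<bar>K\<bar>\<^sup>2 < 16 ^ n"
    using real_arch_pow[of 16 "\<bar>K\<bar> ^ 4 + \<bar>K\<bar>\<^sup>2"] by auto
  obtain N where N: "real N > max 1 (8192 * C / \<epsilon>)"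
    using reals_Archimedean2 by blast
  then have N1: "real N > 0" "8192 * C \<le> \<epsilon> * real N"
    using \<epsilon> by (auto simp: field_simps)
  define I where "I = {n..<n + N}"
  \<comment> \<open>The squared horizontal gradient of \<open>gauge4\<close>.\<close>
  define G where "G p = (dx gauge4 p)\<^sup>2 + (fst p)\<^sup>2 * (dy gauge4 p)\<^sup>2" for p
  define \<phi> where "\<phi> p = (\<Sum>k\<in>I. chi k p) * (1 / real N)" for p
  note Cs = C1_sum[of chi I, OF C1_chi(1)]
  have C\<phi>: "C1 \<phi>" and d\<phi>: "dx \<phi> = (\<lambda>p. (\<Sum>k\<in>I. chi_weight k p) * dx gauge4 p / real N)"
     "dy \<phi> = (\<lambda>p. (\<Sum>k\<in>I. chi_weight k p) * dy gauge4 p / real N)"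
    unfolding \<phi>_def C1_mult(2,3)[OF Cs(1) C1_const(1)]
    by (rule C1_mult(1)[OF Cs(1) C1_const(1)])
       (simp_all add: Cs C1_chi C1_const sum_distrib_right)
  have supp: "chi k p = 0" if "norm p > 1 + 2 * 16 ^ k" for k p
  proof -
    have "1 + 2 * 16 ^ k \<le> (1 + 2 * 16 ^ k :: real)\<^sup>2" by (rule self_le_power) auto
    also have "\<dots> \<le> (norm p)\<^sup>2" using that by (intro power_mono) auto
    finally show ?thesis using gauge4_bounds(2)[of p] by (intro chi_eq_0) simp
  qed
  have "bounded {p. \<phi> p \<noteq> 0}"
    unfolding \<phi>_def
    by (intro bounded_support_mult(1) bounded_support_sum)
       (auto simp: I_def intro: bounded_supportI supp)
  then have Cc: "C1_compact_support \<phi>" using C\<phi> by (simp add: C1_compact_support_iff)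
  have flat: "\<phi> p = 1 \<and> dx \<phi> p = 0 \<and> dy \<phi> p = 0" if p: "norm p \<le> K" for p
  proof -
    have "norm p ^ 4 + (norm p)\<^sup>2 \<le> \<bar>K\<bar> ^ 4 + \<bar>K\<bar>\<^sup>2"
      using p by (intro add_mono power_mono) auto
    then have g: "gauge4 p \<le> 16 ^ n" using gauge4_bounds(3)[of p] n by simp
    have g': "gauge4 p \<le> 16 ^ k" if "k \<in> I" for k
    proof -
      have "(16::real) ^ n \<le> 16 ^ k" using that by (intro power_increasing) (auto simp: I_def)
      with g show ?thesis by (rule order_trans)
    qed
    have "(\<Sum>k\<in>I. chi k p) = real N"
      using sum.cong[of I I "\<lambda>k. chi k p" "\<lambda>k. 1", OF refl chi_eq_1[OF g']] by (simp add: I_def)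
    moreover have "(\<Sum>k\<in>I. chi_weight k p) = 0"
      using g' chi_weight_nonzero(1) by (intro sum.neutral) (metis not_less)
    ultimately show ?thesis using N1 by (simp add: \<phi>_def d\<phi>)
  qed
  have cw: "continuous_on UNIV (chi_weight k)" for k
    unfolding chi_weight_def sqpos_def by (intro continuous_intros C1_continuous C1_gauge4) auto
  have cG: "continuous_on UNIV G"
    unfolding G_def by (intro continuous_intros C1_conts C1_gauge4)
  have bw: "bounded {p. chi_weight k p \<noteq> 0}" for k
  proof (rule bounded_supportI)
    fix p :: "real \<times> real" assume p: "norm p > 1 + 2 * 16 ^ k"
    show "chi_weight k p = 0"
    proof (rule ccontr)
      assume "chi_weight k p \<noteq> 0"
      then have "gauge4 p < 2 * 16 ^ k" by (rule chi_weight_nonzero)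
      then have "(norm p)\<^sup>2 < 1 + 2 * 16 ^ k" using gauge4_bounds(2)[of p] by simp
      also have "\<dots> \<le> (1 + 2 * 16 ^ k :: real)\<^sup>2" by (rule self_le_power) auto
      also have "\<dots> \<le> (norm p)\<^sup>2" using p by (intro power_mono) auto
      finally show False by simp
    qed
  qed
  have i: "integrable lborel (\<lambda>p. f p * ((chi_weight k p * chi_weight k p) * G p))" for k
    by (intro integrable_bounded_support bounded_support_mult(2) continuous_intros f cG cw bounded_support_mult(1) bw)
  have one: "(LINT p|lborel. f p * ((chi_weight k p * chi_weight k p) * G p)) \<le> 8192 * C" for k
  proof -
    \<comment> \<open>The extra factor 2 makes \<open>R > 1\<close> even for \<open>k = 0\<close>,
      and the ball still contains the shell because \<open>2 * 16 ^ k < R ^ 4\<close>.\<close>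
    define R :: real where "R = 2 * 2 ^ k"
    have "(1::real) \<le> 2 ^ k" by simp
    then have R: "R > 1" unfolding R_def by linarith
    have R4: "R ^ 4 = 16 * 16 ^ k"
      unfolding R_def power_mult_distrib power_mult[symmetric]
      by (simp add: mult.commute[of k] power_mult)
    have int: "set_integrable lborel (grushin_ball R) (\<lambda>p. (fst p)\<^sup>2 * f p)"
      by (intro set_integrable_grushin_ball continuous_intros f)
    have "(LINT p|lborel. f p * ((chi_weight k p * chi_weight k p) * G p))
        \<le> (LINT p|lborel. 512 / 16 ^ k * (indicator (grushin_ball R) p *\<^sub>R ((fst p)\<^sup>2 * f p)))"
    proof (rule integral_mono[OF i])
      show "integrable lborel (\<lambda>p. 512 / 16 ^ k * (indicator (grushin_ball R) p *\<^sub>R ((fst p)\<^sup>2 * f p)))"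
        using int unfolding set_integrable_def by (rule integrable_mult_right)
      fix p :: "real \<times> real"
      show "f p * ((chi_weight k p * chi_weight k p) * G p)
          \<le> 512 / 16 ^ k * (indicator (grushin_ball R) p *\<^sub>R ((fst p)\<^sup>2 * f p))"
      proof (cases "chi_weight k p = 0")
        case True
        then show ?thesis using f(2)[of p] by (auto simp: indicator_def)
      next
        case False
        note w = chi_weight_nonzero[OF False]
        have "p \<in> grushin_ball R" using w(2) R4 gauge4_bounds(1)[of p] by (simp add: grushin_ball_gauge4)
        moreover have "(chi_weight k p * chi_weight k p) * G p \<le> 512 / 16 ^ k * (fst p)\<^sup>2"
        proof -
          have "G p = (fst p)\<^sup>2 * (16 * ((fst p)\<^sup>2)\<^sup>2 + 4 * (snd p)\<^sup>2)"
            unfolding G_def C1_gauge4 by (simp add: power_mult_distrib) (simp add: algebra_simps flip: power_mult power_add)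
          also have "\<dots> \<le> (fst p)\<^sup>2 * (16 * gauge4 p)"
            by (intro mult_left_mono) (auto simp: gauge4_def power2_eq_square)
          also have "\<dots> \<le> (fst p)\<^sup>2 * (16 * (2 * 16 ^ k))"
            using w(2) by (intro mult_left_mono) auto
          finally have "G p \<le> (fst p)\<^sup>2 * (32 * 16 ^ k)" by simp
          moreover have "G p \<ge> 0" by (simp add: G_def)
          ultimately have "(chi_weight k p)\<^sup>2 * G p \<le> 16 / (16 ^ k)\<^sup>2 * ((fst p)\<^sup>2 * (32 * 16 ^ k))"
            using w(3) by (intro mult_mono) auto
          also have "\<dots> = 512 / 16 ^ k * (fst p)\<^sup>2" by (simp add: power2_eq_square)
          finally show ?thesis by (simp add: power2_eq_square)
        qed
        then have "f p * ((chi_weight k p * chi_weight k p) * G p) \<le> f p * (512 / 16 ^ k * (fst p)\<^sup>2)"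
          by (rule mult_left_mono) (rule f(2))
        ultimately show ?thesis by (simp add: mult_ac)
      qed
    qed
    also have "\<dots> = 512 / 16 ^ k * (LINT p:grushin_ball R|lborel. (fst p)\<^sup>2 * f p)"
      unfolding set_lebesgue_integral_def by simp
    also have "\<dots> \<le> 512 / 16 ^ k * (C * R ^ 4)"
      by (intro mult_left_mono growth R) auto
    also have "\<dots> = 8192 * C" by (simp add: R4)
    finally show ?thesis .
  qed
  have "f p * (norm (grad \<phi> p))\<^sup>2 = (\<Sum>k\<in>I. f p * ((chi_weight k p * chi_weight k p) * G p)) * (1 / (real N)\<^sup>2)" for p
  proof -
    have "(norm (grad \<phi> p))\<^sup>2 = (\<Sum>k\<in>I. chi_weight k p)\<^sup>2 * G p / (real N)\<^sup>2"
      unfolding grad_norm grad_inner d\<phi> G_def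
      by (simp add: power2_eq_square algebra_simps add_divide_distrib)
    then show ?thesis
      unfolding I_def sum_chi_weight_squared sum_distrib_left[symmetric] sum_distrib_right[symmetric]
      by (simp add: power2_eq_square)
  qed
  then have "(LINT p|lborel. f p * (norm (grad \<phi> p))\<^sup>2)
      = (\<Sum>k\<in>I. LINT p|lborel. f p * ((chi_weight k p * chi_weight k p) * G p)) * (1 / (real N)\<^sup>2)"
    using i by simp
  also have "\<dots> \<le> (\<Sum>k\<in>I. 8192 * C) * (1 / (real N)\<^sup>2)"
    by (intro mult_right_mono sum_mono one) auto
  also have "\<dots> = 8192 * C / real N"
    using N1(1) by (simp add: I_def power2_eq_square)
  also have "\<dots> \<le> \<epsilon>" using N1 by (simp add: field_simps)
  finally show ?thesis using Cc flat by blast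
qed

section \<open>Flat level sets\<close>

text \<open>A constant \<open>dy v = c\<close> makes the weighted integrand at least
  \<open>x^4 c^2\<close>. Over a box of area comparable to \<open>R ^ 3\<close> with
  \<open>x\<close> comparable to \<open>R\<close> this contributes order \<open>R ^ 7\<close>,
  against the allowed \<open>R ^ 4\<close>.\<close>

lemma linear_growth_excluded:
  assumes v: "C1 v" and dy: "\<And>p. dy v p = c"
    and growth: "\<And>R. R > 1 \<Longrightarrow>
      (LINT p:grushin_ball R|lborel. (fst p)\<^sup>2 * (norm (grad v p))\<^sup>2) \<le> C * R ^ 4"
  shows "c = 0"
proof (rule ccontr)
  assume c: "c \<noteq> 0"
  have *: "R ^ 3 * c\<^sup>2 \<le> 2048 * C" if R: "R > 1" for R
  proof -
    \<comment> \<open>The box stays away from the degenerate line \<open>x = 0\<close> and lies in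
      the ball since \<open>1/16 + 1/4 < 1\<close>. Its area is \<open>R ^ 3 / 8\<close>, and
      \<open>8 * 4 ^ 4 = 2048\<close>.\<close>
    let ?Q = "cbox (R / 4, 0) (R / 2, R\<^sup>2 / 2)"
    have sub: "p \<in> grushin_ball R" if "p \<in> ?Q" for p
    proof -
      have b: "0 \<le> fst p" "fst p \<le> R / 2" "0 \<le> snd p" "snd p \<le> R\<^sup>2 / 2"
        using that R by (auto simp: cbox_Pair_eq)
      have "fst p ^ 4 \<le> (R / 2) ^ 4" "(snd p)\<^sup>2 \<le> (R\<^sup>2 / 2)\<^sup>2"
        using b by (auto intro: power_mono)
      moreover have "(R / 2) ^ 4 + (R\<^sup>2 / 2)\<^sup>2 = 5 / 16 * R ^ 4" by (simp add: power_divide)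
      moreover have "R ^ 4 > 0" using R by simp
      ultimately have "fst p ^ 4 + (snd p)\<^sup>2 < R ^ 4" by linarith
      then show ?thesis by (cases p) (simp add: grushin_ball_def)
    qed
    have cont: "continuous_on UNIV (\<lambda>p. (fst p)\<^sup>2 * (norm (grad v p))\<^sup>2)"
      unfolding grad_norm grad_inner by (intro continuous_intros C1_conts v)
    have "(LINT p|lborel. indicator ?Q p *\<^sub>R ((R / 4) ^ 4 * c\<^sup>2))
        \<le> (LINT p:grushin_ball R|lborel. (fst p)\<^sup>2 * (norm (grad v p))\<^sup>2)"
      unfolding set_lebesgue_integral_def
    proof (rule integral_mono)
      show "integrable lborel (\<lambda>p. indicator ?Q p *\<^sub>R ((R / 4) ^ 4 * c\<^sup>2))"
        by (rule borel_integrable_compact) auto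
      show "integrable lborel (\<lambda>p. indicator (grushin_ball R) p *\<^sub>R ((fst p)\<^sup>2 * (norm (grad v p))\<^sup>2))"
        using set_integrable_grushin_ball[OF cont] unfolding set_integrable_def .
      fix p :: "real \<times> real"
      show "indicator ?Q p *\<^sub>R ((R / 4) ^ 4 * c\<^sup>2)
          \<le> indicator (grushin_ball R) p *\<^sub>R ((fst p)\<^sup>2 * (norm (grad v p))\<^sup>2)"
      proof (cases "p \<in> ?Q")
        case True
        then have "R / 4 \<le> fst p" by (cases p) (simp add: cbox_Pair_eq)
        then have "(R / 4) ^ 4 * c\<^sup>2 \<le> fst p ^ 4 * c\<^sup>2"
          using R by (intro mult_right_mono power_mono) auto
        also have "\<dots> \<le> fst p ^ 4 * c\<^sup>2 + (fst p * dx v p)\<^sup>2" by simp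
        also have "\<dots> = (fst p)\<^sup>2 * (norm (grad v p))\<^sup>2"
          unfolding grad_norm grad_inner dy by (simp add: power2_eq_square power4_eq_xxxx algebra_simps)
        finally show ?thesis using True sub by simp
      qed (auto simp: indicator_def)
    qed
    also have "\<dots> \<le> C * R ^ 4" by (rule growth[OF R])
    also have "(LINT p|lborel. indicator ?Q p *\<^sub>R ((R / 4) ^ 4 * c\<^sup>2)) = measure lborel ?Q * ((R / 4) ^ 4 * c\<^sup>2)"
      by (simp add: emeasure_lborel_cbox_finite)
    also have "measure lborel ?Q = (R / 4) * (R\<^sup>2 / 2)"
      using R by (simp add: content_Pair)
    finally have "R ^ 4 * (R ^ 3 * c\<^sup>2) \<le> R ^ 4 * (2048 * C)"
      by (simp add: power_divide power2_eq_square power3_eq_cube power4_eq_xxxx mult_ac)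
    then show ?thesis by (rule mult_left_le_imp_le) (use R in simp)
  qed
  \<comment> \<open>Chosen so that \<open>R * c^2\<close> alone exceeds \<open>2048 * C\<close>; the
    summand 2 gives strictness and \<open>R > 1\<close>.\<close>
  define R where "R = 2 + 2048 * \<bar>C\<bar> / c\<^sup>2"
  have "R \<ge> 2" by (simp add: R_def)
  then have "R \<le> R ^ 3" by (intro self_le_power) auto
  then have "R * c\<^sup>2 \<le> R ^ 3 * c\<^sup>2" by (rule mult_right_mono) simp
  also have "\<dots> \<le> 2048 * C" using * \<open>R \<ge> 2\<close> by simp
  finally have "R * c\<^sup>2 \<le> 2048 * C" .
  moreover have "R * c\<^sup>2 = 2 * c\<^sup>2 + 2048 * \<bar>C\<bar>" using c by (simp add: R_def distrib_right)
  moreover have "c\<^sup>2 > 0" using c by simp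
  ultimately show False by linarith
qed

text \<open>If \<open>v\<close> depends on \<open>x\<close> alone, its unit horizontal normal is
  \<open>X\<close> or \<open>-X\<close>, with a sign that is constant near any point where the
  gradient is nonzero.\<close>

lemma curvatures_eq_0:
  assumes v: "C1 (dx v)" and dy: "\<And>p. dy v p = 0" and dyx: "\<And>p. dy (dx v) p = 0"
    and ne: "grad v p \<noteq> 0"
  shows "curvA v p = 0" "curvB v p = 0"
proof -
  have Y0: "Y v = (\<lambda>p. 0)" by (simp add: Y_eq dy)
  have nrm: "norm (grad v q) = \<bar>dx v q\<bar>" for q
  proof -
    have "(norm (grad v q))\<^sup>2 = (dx v q)\<^sup>2"
      unfolding grad_norm grad_inner dy by (simp add: power2_eq_square)
    then show ?thesis using abs_eq_iff power2_eq_iff by (metis abs_norm_cancel)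
  qed
  have xp: "dx v p \<noteq> 0" using ne nrm[of p] by auto
  have e1: "eta v q $ 1 = sgn (dx v q)" and e2: "eta v q $ 2 = 0" for q
    by (simp_all add: eta_def nrm Y0 X_def sgn_real_def abs_if)
  \<comment> \<open>The neighbourhood on which \<open>dx v\<close> keeps its sign at
    \<open>p\<close>: there \<open>eta v\<close> is constant, although \<open>sgn\<close> may jump
    elsewhere.\<close>
  define S where "S = {q. 0 < dx v q * dx v p}"
  have "open S"
    unfolding S_def by (intro open_Collect_less continuous_intros C1_continuous v)
  moreover have "p \<in> S" using xp by (simp add: S_def zero_less_mult_iff) linarith
  moreover have "eta v q $ 1 = sgn (dx v p)" if "q \<in> S" for q
    using that by (auto simp: S_def e1 zero_less_mult_iff)
  ultimately have "dx (\<lambda>q. eta v q $ 1) p = dx (\<lambda>q. sgn (dx v p)) p"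
    by (rule dx_dy_cong)
  then show "curvA v p = 0"
    unfolding curvA_def div_XY_def X_def Y_eq e2 by (simp add: C1_const)
  \<comment> \<open>\<open>tau v p\<close> has first component 0, so only the second column of
    \<open>H_ess v p\<close> acts, and both of its entries vanish.\<close>
  have H: "H_ess v p *v tau v p = 0"
    unfolding H_ess_def tau_def Y0 X_def Y_eq dyx dy
    by (simp add: vec_eq_iff forall_2 matrix_vector_mult_def sum_2 C1_const)
  show "curvB v p = 0"
    unfolding curvB_def H Z_def dy by simp
qed

section \<open>From the nonlinear system to the weak form of its derivatives\<close>

lemma chain_rule:
  fixes h :: "real^'m::finite \<Rightarrow> real" and u :: "real \<times> real \<Rightarrow> real^'m"
  assumes h: "C1 h" and u: "C1 u"
  shows "continuous_on S (partial j h)" "C1 (\<lambda>p. h (u p))"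
    "dx (\<lambda>p. h (u p)) = (\<lambda>p. \<Sum>j\<in>UNIV. partial j h (u p) * dx (coord u j) p)"
    "dy (\<lambda>p. h (u p)) = (\<lambda>p. \<Sum>j\<in>UNIV. partial j h (u p) * dy (coord u j) p)"
proof -
  obtain h' where h': "\<And>v. (h has_derivative blinfun_apply (h' v)) (at v)" "continuous_on UNIV h'"
    using h unfolding C1_def by blast
  \<comment> \<open>Identifying the one-variable \<open>deriv\<close> with the Frechet derivative is
    what gives continuity of the coupling coefficients.\<close>
  have part: "partial j h = (\<lambda>v. blinfun_apply (h' v) (axis j 1))" for j
  proof
    fix v :: "real^'m"
    have "((\<lambda>t. v + t *\<^sub>R axis j 1) has_derivative (\<lambda>t. t *\<^sub>R axis j 1)) (at 0)"
      by (auto intro!: derivative_eq_intros)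
    from has_derivative_compose[OF this, of h "blinfun_apply (h' v)"] h'(1)[of v]
    have "((\<lambda>t. h (v + t *\<^sub>R axis j 1)) has_field_derivative blinfun_apply (h' v) (axis j 1)) (at 0)"
      by (simp add: has_field_derivative_def blinfun.scaleR_right mult_commute_abs)
    then show "partial j h v = blinfun_apply (h' v) (axis j 1)"
      unfolding partial_def by (rule DERIV_imp_deriv)
  qed
  show cont: "continuous_on S (partial j h)" for j S
    unfolding part using continuous_on_subset[OF h'(2), of S] by (auto intro!: continuous_intros)
  have expand: "blinfun_apply (h' v) w = (\<Sum>j\<in>UNIV. w $ j * partial j h v)" for v w
  proof -
    have "w = (\<Sum>j\<in>UNIV. w $ j *\<^sub>R axis j 1)"
      by (simp add: vec_eq_iff axis_def if_distrib[of "(*) _"] cong: if_cong)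
    then have "blinfun_apply (h' v) w = blinfun_apply (h' v) (\<Sum>j\<in>UNIV. w $ j *\<^sub>R axis j 1)" by simp
    then show ?thesis by (simp add: blinfun.sum_right blinfun.scaleR_right part)
  qed
  obtain u' where u': "\<And>p. (u has_derivative blinfun_apply (u' p)) (at p)"
    using u unfolding C1_def by blast
  have Cu: "C1 (coord u j)" for j
    using C1_compose_bounded_linear[OF u bounded_linear_vec_nth] .
  have coord: "blinfun_apply (u' p) k $ j = fst k * dx (coord u j) p + snd k * dy (coord u j) p" for p k j
    using has_derivative_unique[OF bounded_linear.has_derivative[OF bounded_linear_vec_nth u'(1)]
        C1_has_derivative[OF Cu]] by meson
  have 1: "((\<lambda>p. h (u p)) has_derivative (\<lambda>k. fst k * (\<Sum>j\<in>UNIV. partial j h (u p) * dx (coord u j) p)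
      + snd k * (\<Sum>j\<in>UNIV. partial j h (u p) * dy (coord u j) p))) (at p)" for p
    by (rule has_derivative_eq_rhs[OF has_derivative_compose[OF u' h'(1)]])
       (simp add: expand coord sum_distrib_left sum.distrib[symmetric] algebra_simps)
  have 2: "continuous_on UNIV (\<lambda>p. partial j h (u p))" for j
    by (rule continuous_on_compose2[OF cont[of UNIV] C1_continuous[OF u]]) auto
  have 3: "continuous_on UNIV (\<lambda>p. \<Sum>j\<in>UNIV. partial j h (u p) * dx (coord u j) p)"
    "continuous_on UNIV (\<lambda>p. \<Sum>j\<in>UNIV. partial j h (u p) * dy (coord u j) p)"
    by (intro continuous_intros 2 C1_conts Cu)+
  show "C1 (\<lambda>p. h (u p))"
    "dx (\<lambda>p. h (u p)) = (\<lambda>p. \<Sum>j\<in>UNIV. partial j h (u p) * dx (coord u j) p)"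
    "dy (\<lambda>p. h (u p)) = (\<lambda>p. \<Sum>j\<in>UNIV. partial j h (u p) * dy (coord u j) p)"
    by (rule C1I[OF 1 3])+
qed

lemma C2_imp_C1:
  assumes "C2 u"
  shows "C1 u"
  using assms C1_continuous unfolding C2_def C1_def[of u] by blast

text \<open>Summation of the scalar equations over \<open>i\<close>. They pair \<open>M i j\<close>
  with \<open>a j\<close> and \<open>\<psi> i\<close>, the energy with \<open>a i\<close> and
  \<open>\<psi> j\<close>; symmetry reconciles the two.\<close>

lemma integral_energy_linearized:
  fixes M :: "'m::finite \<Rightarrow> 'm \<Rightarrow> real \<times> real \<Rightarrow> real"
  assumes M: "\<And>i j. continuous_on UNIV (M i j)" "\<And>i j p. M i j p = M j i p"
    and a: "\<And>i. C1 (a i)" and s: "\<And>i. continuous_on UNIV (s i)"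
    and eq: "\<And>i \<psi>. C1_compact_support \<psi> \<Longrightarrow>
      (LINT p|lborel. grad (a i) p \<bullet> grad \<psi> p + (\<Sum>j\<in>UNIV. M i j p * a j p) * \<psi> p) = (LINT p|lborel. s i p * \<psi> p)"
    and \<psi>: "\<And>i. C1_compact_support (\<psi> i)"
  shows "(LINT p|lborel. energy M a \<psi> p) = (LINT p|lborel. (\<Sum>i\<in>UNIV. s i p * \<psi> i p))"
proof -
  have \<psi>': "C1 (\<psi> i)" "bounded {p. \<psi> i p \<noteq> 0}" for i
    using \<psi> unfolding C1_compact_support_iff by auto
  have "energy M a \<psi> p
      = (\<Sum>i\<in>UNIV. grad (a i) p \<bullet> grad (\<psi> i) p + (\<Sum>j\<in>UNIV. M i j p * a j p) * \<psi> i p)" for p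
    unfolding energy_def sum.distrib sum_distrib_right
    by (subst (2) sum.swap) (simp add: M(2))
  moreover have "integrable lborel (\<lambda>p. grad (a i) p \<bullet> grad (\<psi> i) p + (\<Sum>j\<in>UNIV. M i j p * a j p) * \<psi> i p)" for i
    unfolding grad_inner
    by (intro integrable_bounded_support bounded_support_add bounded_support_mult(2) bounded_support_dx
        bounded_support_dy continuous_intros C1_conts a M \<psi>')
  moreover have "integrable lborel (\<lambda>p. s i p * \<psi> i p)" for i
    by (intro integrable_bounded_support bounded_support_mult(2) continuous_intros C1_conts s \<psi>')
  ultimately show ?thesis by (simp add: eq[OF \<psi>])
qed

theorem theorem4p1:
  fixes H :: "real^'m::finite \<Rightarrow> real^'m"
    and u :: "real \<times> real \<Rightarrow> real^'m"
  assumes "\<forall>i. C1 (coord H i)"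
    and "C2 u"
    and "symmetric_system H u"
    and "stable_solution H u"
    and "\<forall>i p. Z (Y (coord u i)) p * X (coord u i) p - Z (X (coord u i)) p * Y (coord u i) p \<le> 0"
    and "\<exists>C. \<forall>R>1. \<forall>i.
           (LINT p:grushin_ball R|lborel. (fst p)\<^sup>2 * (norm (grad (coord u i) p))\<^sup>2) \<le> C * R ^ 4"
  shows "\<forall>i p. grad (coord u i) p \<noteq> 0 \<longrightarrow> curvA (coord u i) p = 0 \<and> curvB (coord u i) p = 0"
proof -
  note v = C2_coord[OF assms(2)]
  define M where "M i j p = partial i (coord H j) (u p)" for i j p
  note chain = chain_rule[OF assms(1)[rule_format] C2_imp_C1[OF assms(2)]]
  have M: "continuous_on UNIV (M i j)" "M i j p = M j i p" for i j p
  proof -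
    show "continuous_on UNIV (M i j)"
      unfolding M_def
      by (rule continuous_on_compose2[OF chain(1)[of UNIV] C1_continuous[OF C2_imp_C1[OF assms(2)]]]) auto
    show "M i j p = M j i p"
      using assms(3) unfolding symmetric_system_def M_def by blast
  qed
  define a b where "a i = X (coord u i)" and "b i = Y (coord u i)" for i
  define s t where "s i p = 2 * Z (Y (coord u i)) p" and "t i p = - 2 * Z (X (coord u i)) p" for i p
  have Ca: "C1 (a i)" and Cb: "C1 (b i)" for i
    unfolding a_def b_def X_def using v C1_Y(1) by auto
  have cs: "continuous_on UNIV (s i)" and ct: "continuous_on UNIV (t i)" for i
    unfolding s_def t_def Z_def using Ca[unfolded a_def] Cb[unfolded b_def]
    by (auto intro!: continuous_intros C1_continuous_dy)
  define F where "F i p = H (u p) $ i" for i p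
  have CF: "C1 (F i)" and XF: "X (F i) p = (\<Sum>j\<in>UNIV. M i j p * a j p)"
    and YF: "Y (F i) p = (\<Sum>j\<in>UNIV. M i j p * b j p)" for i p
  proof -
    show "C1 (F i)" using chain(2) unfolding F_def .
    \<comment> \<open>The chain rule yields \<open>partial j (coord H i)\<close>, the transposed
      entry; this is where the system has to be symmetric.\<close>
    show "X (F i) p = (\<Sum>j\<in>UNIV. M i j p * a j p)"
      unfolding X_def a_def F_def chain(3) M(2)[of i] by (simp add: M_def)
    show "Y (F i) p = (\<Sum>j\<in>UNIV. M i j p * b j p)"
      unfolding Y_def b_def F_def chain(4) M(2)[of i] by (simp add: M_def sum_distrib_left mult_ac)
  qed
  have Feq: "F i p = dx (dx (coord u i)) p + (fst p)\<^sup>2 * dy (dy (coord u i)) p" for i p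
    using assms(4) unfolding stable_solution_def solution_def F_def by (cases p) simp
  have lin: "(LINT p|lborel. grad (a i) p \<bullet> grad \<psi> p + (\<Sum>j\<in>UNIV. M i j p * a j p) * \<psi> p) = (LINT p|lborel. s i p * \<psi> p)"
    "(LINT p|lborel. grad (b i) p \<bullet> grad \<psi> p + (\<Sum>j\<in>UNIV. M i j p * b j p) * \<psi> p) = (LINT p|lborel. t i p * \<psi> p)"
    if "C1_compact_support \<psi>" for i \<psi>
    using linearized_equations[OF v CF Feq, of \<psi>] that
    unfolding C1_compact_support_iff XF YF s_def t_def a_def b_def by auto
  have weak: "(LINT p|lborel. energy M a \<psi> p) = (LINT p|lborel. (\<Sum>i\<in>UNIV. s i p * \<psi> i p))"
    "(LINT p|lborel. energy M b \<psi> p) = (LINT p|lborel. (\<Sum>i\<in>UNIV. t i p * \<psi> i p))"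
    if "\<And>i. C1_compact_support (\<psi> i)" for \<psi>
    by (rule integral_energy_linearized[OF M Ca cs lin(1) that],
        assumption, rule integral_energy_linearized[OF M Cb ct lin(2) that])
  have nonneg: "0 \<le> (LINT p|lborel. energy M \<zeta> \<zeta> p)" if \<zeta>: "\<And>i. C1_compact_support (\<zeta> i)" for \<zeta>
  proof -
    have \<zeta>': "C1 (\<zeta> i)" "bounded {p. \<zeta> i p \<noteq> 0}" for i
      using \<zeta> unfolding C1_compact_support_iff by auto
    have "integrable lborel (\<lambda>p. grad (\<zeta> i) p \<bullet> grad (\<zeta> i) p)" for i
      unfolding grad_inner
      by (intro integrable_bounded_support bounded_support_add bounded_support_mult(2) bounded_support_dx
          bounded_support_dy continuous_intros C1_conts \<zeta>')
    moreover have "integrable lborel (\<lambda>p. M i j p * \<zeta> i p * \<zeta> j p)" for i j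
      by (intro integrable_bounded_support bounded_support_mult(2) continuous_intros C1_conts M \<zeta>')
    ultimately have "(LINT p|lborel. energy M \<zeta> \<zeta> p)
        = (\<Sum>i\<in>UNIV. LINT p|lborel. (norm (grad (\<zeta> i) p))\<^sup>2)
          + (\<Sum>i\<in>UNIV. \<Sum>j\<in>UNIV. LINT p|lborel. M i j p * \<zeta> i p * \<zeta> j p)"
      unfolding energy_def grad_norm by simp
    moreover have "- (\<Sum>i\<in>UNIV. \<Sum>j\<in>UNIV. LINT p|lborel. M i j p * \<zeta> i p * \<zeta> j p)
        \<le> (\<Sum>i\<in>UNIV. LINT p|lborel. (norm (grad (\<zeta> i) p))\<^sup>2)"
      using assms(4) \<zeta> unfolding stable_solution_def M_def by blast
    ultimately show ?thesis by linarith
  qed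
  obtain C where C: "\<And>R i. R > 1 \<Longrightarrow>
      (LINT p:grushin_ball R|lborel. (fst p)\<^sup>2 * (norm (grad (coord u i) p))\<^sup>2) \<le> C * R ^ 4"
    using assms(6) by blast
  define f where "f p = (\<Sum>i\<in>UNIV. (norm (grad (coord u i) p))\<^sup>2)" for p
  have cg: "continuous_on UNIV (\<lambda>p. (norm (grad (coord u i) p))\<^sup>2)" for i
    unfolding grad_norm grad_inner by (intro continuous_intros C1_conts v)
  have cf: "continuous_on UNIV f" unfolding f_def by (intro continuous_intros cg)
  have f0: "0 \<le> f p" for p unfolding f_def by (intro sum_nonneg) simp
  \<comment> \<open>The cutoff errors of \<open>a\<close> and \<open>b\<close> add up to
    \<open>f\<close> times \<open>|grad \<phi>|^2\<close>, the quantity that the growth condition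
    controls.\<close>
  have fab: "f p = (\<Sum>i\<in>UNIV. (a i p)\<^sup>2) + (\<Sum>i\<in>UNIV. (b i p)\<^sup>2)" for p
    unfolding f_def grad_norm grad_inner a_def b_def X_def Y_def sum.distrib[symmetric]
    by (simp add: power2_eq_square mult_ac)
  have growth: "(LINT p:grushin_ball R|lborel. (fst p)\<^sup>2 * f p) \<le> (real CARD('m) * C) * R ^ 4"
    if R: "R > 1" for R
  proof -
    have "(LINT p:grushin_ball R|lborel. (fst p)\<^sup>2 * f p)
        = (\<Sum>i\<in>UNIV. LINT p:grushin_ball R|lborel. (fst p)\<^sup>2 * (norm (grad (coord u i) p))\<^sup>2)"
    proof -
      have "integrable lborel (\<lambda>p. indicator (grushin_ball R) p *\<^sub>R ((fst p)\<^sup>2 * (norm (grad (coord u i) p))\<^sup>2))" for i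
        unfolding set_integrable_def[symmetric]
        by (intro set_integrable_grushin_ball continuous_intros cg)
      then show ?thesis
        unfolding set_lebesgue_integral_def f_def sum_distrib_left scaleR_sum_right
        by (rule Bochner_Integration.integral_sum)
    qed
    also have "\<dots> \<le> (\<Sum>i\<in>(UNIV :: 'm set). C * R ^ 4)" by (intro sum_mono C R)
    finally show ?thesis by (simp add: mult_ac)
  qed
  have cutoff: "\<exists>\<phi>. C1_compact_support \<phi> \<and>
      (\<forall>p. norm p \<le> K \<longrightarrow> \<phi> p = 1 \<and> dx \<phi> p = 0 \<and> dy \<phi> p = 0) \<and>
      (LINT p|lborel. energy M (\<lambda>i p. \<phi> p * a i p) (\<lambda>i p. \<phi> p * a i p) p) \<le> \<epsilon> \<and>
      (LINT p|lborel. energy M (\<lambda>i p. \<phi> p * b i p) (\<lambda>i p. \<phi> p * b i p) p) \<le> \<epsilon>"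
    if \<epsilon>: "\<epsilon> > 0" for K \<epsilon>
  proof -
    obtain \<phi> where \<phi>: "C1_compact_support \<phi>"
      and flat: "\<forall>p. norm p \<le> K \<longrightarrow> \<phi> p = 1 \<and> dx \<phi> p = 0 \<and> dy \<phi> p = 0"
      and small: "(LINT p|lborel. f p * (norm (grad \<phi> p))\<^sup>2) \<le> \<epsilon>"
      using cutoff_exists[OF cf f0 growth \<epsilon>, of K] by blast
    have \<phi>': "C1 \<phi>" "bounded {p. \<phi> p \<noteq> 0}"
      using \<phi> unfolding C1_compact_support_iff by auto
    define Qa Qb where "Qa = (LINT p|lborel. energy M (\<lambda>i p. \<phi> p * a i p) (\<lambda>i p. \<phi> p * a i p) p)"
      and "Qb = (LINT p|lborel. energy M (\<lambda>i p. \<phi> p * b i p) (\<lambda>i p. \<phi> p * b i p) p)"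
    have c: "C1_compact_support (\<lambda>p. \<phi> p * w p)" if "C1 w" for w
      unfolding C1_compact_support_iff by (intro conjI C1_mult(1) bounded_support_mult(1) \<phi>' that)
    have c1: "C1 (\<lambda>p. \<phi> p * w p)" if "C1 w" for w by (rule C1_mult(1)[OF \<phi>'(1) that])
    have "Qa \<ge> 0" "Qb \<ge> 0" unfolding Qa_def Qb_def by (intro nonneg c Ca Cb)+
    have ig: "integrable lborel (\<lambda>p. (\<Sum>i\<in>UNIV. (w i p)\<^sup>2) * (norm (grad \<phi> p))\<^sup>2)"
      if "\<And>i. C1 (w i)" for w :: "'m \<Rightarrow> real \<times> real \<Rightarrow> real"
      unfolding grad_norm grad_inner
      by (intro integrable_bounded_support bounded_support_mult(2) bounded_support_add bounded_support_dx
          bounded_support_dy continuous_intros C1_conts that \<phi>')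
    have ir: "integrable lborel (\<lambda>p. (\<Sum>i\<in>UNIV. r i p * (\<phi> p * (\<phi> p * w i p))))"
      if "\<And>i. C1 (w i)" "\<And>i. continuous_on UNIV (r i)" for w r :: "'m \<Rightarrow> real \<times> real \<Rightarrow> real"
      by (intro integrable_bounded_support bounded_support_sum finite bounded_support_mult(2)[OF bounded_support_mult(1)]
          continuous_intros C1_conts that \<phi>')
    \<comment> \<open>The weak equation is tested with \<open>\<phi>^2 a\<close>, which is C1 with
      compact support.\<close>
    have Qa: "Qa = (LINT p|lborel. (\<Sum>i\<in>UNIV. (a i p)\<^sup>2) * (norm (grad \<phi> p))\<^sup>2)
        + (LINT p|lborel. (\<Sum>i\<in>UNIV. s i p * (\<phi> p * (\<phi> p * a i p))))"
      unfolding Qa_def energy_localize[OF Ca \<phi>'(1)] weak(1)[OF c[OF c1[OF Ca]], symmetric]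
      by (rule Bochner_Integration.integral_add[OF ig[OF Ca] integrable_energy[OF M(1) Ca c[OF c1[OF Ca]]]])
    have Qb: "Qb = (LINT p|lborel. (\<Sum>i\<in>UNIV. (b i p)\<^sup>2) * (norm (grad \<phi> p))\<^sup>2)
        + (LINT p|lborel. (\<Sum>i\<in>UNIV. t i p * (\<phi> p * (\<phi> p * b i p))))"
      unfolding Qb_def energy_localize[OF Cb \<phi>'(1)] weak(2)[OF c[OF c1[OF Cb]], symmetric]
      by (rule Bochner_Integration.integral_add[OF ig[OF Cb] integrable_energy[OF M(1) Cb c[OF c1[OF Cb]]]])
    have "Qa + Qb = (LINT p|lborel. f p * (norm (grad \<phi> p))\<^sup>2)
        + (LINT p|lborel. (\<Sum>i\<in>UNIV. s i p * (\<phi> p * (\<phi> p * a i p))) + (\<Sum>i\<in>UNIV. t i p * (\<phi> p * (\<phi> p * b i p))))"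
      unfolding Qa Qb fab distrib_right
      using ig[of a, OF Ca] ig[of b, OF Cb] ir[of a s, OF Ca cs] ir[of b t, OF Cb ct] by simp
    moreover have "(LINT p|lborel. (\<Sum>i\<in>UNIV. s i p * (\<phi> p * (\<phi> p * a i p))) + (\<Sum>i\<in>UNIV. t i p * (\<phi> p * (\<phi> p * b i p)))) \<le> 0"
    proof -
      have "(\<Sum>i\<in>UNIV. s i p * (\<phi> p * (\<phi> p * a i p))) + (\<Sum>i\<in>UNIV. t i p * (\<phi> p * (\<phi> p * b i p))) \<le> 0" for p
        unfolding sum.distrib[symmetric]
      proof (rule sum_nonpos)
        fix i
        have "s i p * (\<phi> p * (\<phi> p * a i p)) + t i p * (\<phi> p * (\<phi> p * b i p))
            = 2 * (\<phi> p)\<^sup>2 * (Z (Y (coord u i)) p * X (coord u i) p - Z (X (coord u i)) p * Y (coord u i) p)"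
          unfolding s_def t_def a_def b_def by (simp add: power2_eq_square algebra_simps)
        \<comment> \<open>The sign condition enters here, pointwise and separately for each
          \<open>i\<close>.\<close>
        also have "\<dots> \<le> 0" by (intro mult_nonneg_nonpos assms(5)[rule_format]) simp
        finally show "s i p * (\<phi> p * (\<phi> p * a i p)) + t i p * (\<phi> p * (\<phi> p * b i p)) \<le> 0" .
      qed
      then have "0 \<le> (LINT p|lborel. - ((\<Sum>i\<in>UNIV. s i p * (\<phi> p * (\<phi> p * a i p)))
          + (\<Sum>i\<in>UNIV. t i p * (\<phi> p * (\<phi> p * b i p)))))"
        by (intro Bochner_Integration.integral_nonneg) (simp only: neg_0_le_iff_le)
      then show ?thesis unfolding Bochner_Integration.integral_minus by simp
    qed
    \<comment> \<open>Only \<open>Qa + Qb\<close> has been bounded; nonnegativity of both terms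
      passes the bound to each.\<close>
    ultimately have "Qa \<le> \<epsilon>" "Qb \<le> \<epsilon>" using small \<open>Qa \<ge> 0\<close> \<open>Qb \<ge> 0\<close> by linarith+
    then show ?thesis using \<phi> flat unfolding Qa_def Qb_def by blast
  qed
  have s0: "s i p = 0" for i p
    by (rule null_vector_source_eq_0[where a = a, OF M nonneg Ca cs weak(1)]) (use cutoff in blast)+
  have t0: "t i p = 0" for i p
    by (rule null_vector_source_eq_0[where a = b, OF M nonneg Cb ct weak(2)]) (use cutoff in blast)+
  have yx: "dy (dx (coord u i)) p = 0" for i p
    using t0[of i p] by (simp add: t_def Z_def X_def)
  \<comment> \<open>The factor \<open>fst p\<close> remains, so nothing is learned here about the
    second y-derivative on the line \<open>x = 0\<close>.\<close>
  have yy: "fst p * dy (dy (coord u i)) p = 0" for i p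
    using s0[of i p] by (simp add: s_def Z_def C1_Y[OF v(3)])
  have xy: "dx (dy (coord u i)) p = 0" for i p
    using dx_dy_commute[OF v(1,2,3)] yx by metis
  have const: "dy (coord u i) p = dy (coord u i) (1, 0)" for i p
  proof -
    have 1: "((\<lambda>t. dy (coord u i) (t, y)) has_field_derivative 0) (at x)" for x y
      using C1_has_field_derivative(1)[OF v(3), of i y x] by (simp add: xy)
    have 2: "((\<lambda>t. dy (coord u i) (1, t)) has_field_derivative 0) (at y)" for y
      using C1_has_field_derivative(2)[OF v(3), of i 1 y] yy[of "(1, y)" i] by simp
    have "dy (coord u i) (fst p, snd p) = dy (coord u i) (1, snd p)"
      by (rule DERIV_isconst_all) (use 1 in blast)
    also have "\<dots> = dy (coord u i) (1, 0)"
      by (rule DERIV_isconst_all) (use 2 in blast)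
    finally show ?thesis by simp
  qed
  \<comment> \<open>The vanishing sources still allow a nonzero constant slope in \<open>y\<close>;
    the growth condition, used a second time, excludes it.\<close>
  have dy0: "dy (coord u i) p = 0" for i p
    using const linear_growth_excluded[OF v(1) const C] by metis
  show ?thesis using curvatures_eq_0[OF v(2) dy0 yx] by blast
qed

end
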